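(* Let $n\ge 2$, let $B$ be an abelian subgroup of $\mathcal{A}_n=\mathrm{Aut}(T_n)$ normalized by the adding machine $\tau$, let $\beta=(\beta|_0,\beta|_1,\dots,\beta|_{n-1})\sigma_\beta\in B$, and let $H=\langle \beta|_i\ (i\in Y),\ \tau\rangle$. (I) Suppose $\sigma_\beta=(\sigma_\tau)^s$ for some integer $s$. Then $H$ is metabelian-by-finite. More precisely, let $m=\frac{n}{\gcd(n,s)}$, for $i\in Y$ let $\pi_i=\beta|_i\,\beta|_{i+s}\,\beta|_{i+2s}\cdots\beta|_{i+(m-1)s}$, and let $$K=\langle [\beta|_i,\tau^k],\ \pi_i \mid k\in\mathbb{Z},\ i\in Y\rangle .$$ Then $K$ is an abelian group and, with $O=K\langle\tau\rangle$, $H$ affords the normal series $$H\trianglerighteq O\trianglerighteq K,$$ where the quotient group $H/O$ is a homomorphic image of a subgroup of the wreath product $C_m\wr C_n$ of the cyclic groups $C_m$, $C_n$ of orders $m$, $n$. (II) Let $n$ be even. Then $H$ is a metabelian group if $\sigma_\beta=(\sigma_\tau)^{n/2}$ or if $\sigma_\beta$ is a transposition.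
   Context: Let $Y=\{0,1,\dots,n-1\}$, and let $T_n$ be the regular rooted $n$-ary tree whose vertices are the finite words over $Y$ (root = empty word). $\mathcal{A}_n=\mathrm{Aut}(T_n)$. Automorphisms act on the right, $\alpha\beta$ means first $\alpha$ then $\beta$, $e$ is the identity, $[a,b]=a^{-1}b^{-1}ab$. Each $\alpha\in\mathcal{A}_n$ is written $\alpha=(\alpha|_0,\dots,\alpha|_{n-1})\sigma_\alpha$, where the permutation $\sigma_\alpha$ of $Y$ (the activity of $\alpha$) and the first level states $\alpha|_i\in\mathcal{A}_n$ are determined by $(iu)\alpha=(i)\sigma_\alpha\cdot(u)\alpha|_i$ for $i\in Y$ and every word $u$. For an integer $j$, $\alpha|_j$ means $\alpha|_{\overline{j}}$, where $\overline{j}\in Y$ is the representative of $j$ modulo $n$. The $n$-ary adding machine is $\tau=(e,\dots,e,\tau)\sigma_\tau$ with $\sigma_\tau=(0,1,\dots,n-1)$, the cycle $i\mapsto i+1\pmod n$. The wreath product $C_m\wr C_n$ is the regular one, of order $m^n n$. *)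

theory Defs
  imports "HOL-Algebra.Group_Action" "HOL-Algebra.Generated_Groups"
    "HOL-Algebra.Elementary_Groups" "HOL-Combinatorics.Permutations"
begin

section \<open>The automorphism group of the rooted \<open>n\<close>-ary tree\<close>

definition words :: "nat \<Rightarrow> nat list set" where
  "words n = lists {..<n}"

definition tree_adj :: "nat list \<Rightarrow> nat list \<Rightarrow> bool" where
  "tree_adj u v \<longleftrightarrow> (\<exists>y. v = u @ [y] \<or> u = v @ [y])"

text \<open>
  Automorphisms are functions on all lists that are the identity outside the vertex set, so that
  equality of functions is equality of automorphisms.  They act on the right: the product
  of \<open>\<alpha>\<close> and \<open>\<beta>\<close> is \<open>\<alpha>\<close> followed by \<open>\<beta>\<close>.
\<close>

definition aut_tree :: "nat \<Rightarrow> (nat list \<Rightarrow> nat list) monoid" where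
  "aut_tree n =
     \<lparr>carrier = {\<alpha>. \<alpha> permutes words n \<and> \<alpha> [] = [] \<and>
                  (\<forall>u\<in>words n. \<forall>v\<in>words n. tree_adj (\<alpha> u) (\<alpha> v) \<longleftrightarrow> tree_adj u v)},
      monoid.mult = (\<lambda>\<alpha> \<beta>. \<beta> \<circ> \<alpha>), one = id\<rparr>"

definition perm_group :: "'a set \<Rightarrow> ('a \<Rightarrow> 'a) monoid" where
  "perm_group S = \<lparr>carrier = {p. p permutes S}, monoid.mult = (\<lambda>p q. q \<circ> p), one = id\<rparr>"

definition activity :: "nat \<Rightarrow> (nat list \<Rightarrow> nat list) \<Rightarrow> nat \<Rightarrow> nat" where
  "activity n \<alpha> i = (if i < n then hd (\<alpha> [i]) else i)"

text \<open>The state at \<open>j\<close> takes an integer index, which is read modulo \<open>n\<close>.\<close>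

definition state :: "nat \<Rightarrow> (nat list \<Rightarrow> nat list) \<Rightarrow> int \<Rightarrow> nat list \<Rightarrow> nat list" where
  "state n \<alpha> j = (\<lambda>u. if u \<in> words n then tl (\<alpha> (nat (j mod int n) # u)) else u)"

definition sigma_tau :: "nat \<Rightarrow> nat \<Rightarrow> nat" where
  "sigma_tau n i = (if i < n then (i + 1) mod n else i)"

fun increment :: "nat \<Rightarrow> nat list \<Rightarrow> nat list" where
  "increment n [] = []"
| "increment n (i # u) = (if i + 1 = n then 0 # increment n u else (i + 1) # u)"

definition adding_machine :: "nat \<Rightarrow> nat list \<Rightarrow> nat list" where
  "adding_machine n = (\<lambda>u. if u \<in> words n then increment n u else u)"

section \<open>Group-theoretic notions\<close>

text \<open>The commutator convention is \<open>[a, b] = a\<^sup>-\<^sup>1 b\<^sup>-\<^sup>1 a b\<close>.\<close>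

definition commutator :: "('a, 'b) monoid_scheme \<Rightarrow> 'a \<Rightarrow> 'a \<Rightarrow> 'a" where
  "commutator G a b = inv\<^bsub>G\<^esub> a \<otimes>\<^bsub>G\<^esub> inv\<^bsub>G\<^esub> b \<otimes>\<^bsub>G\<^esub> a \<otimes>\<^bsub>G\<^esub> b"

definition metabelian :: "('a, 'b) monoid_scheme \<Rightarrow> bool" where
  "metabelian G \<longleftrightarrow> group G \<and> comm_group (G\<lparr>carrier := derived G (carrier G)\<rparr>)"

definition metabelian_by_finite :: "('a, 'b) monoid_scheme \<Rightarrow> bool" where
  "metabelian_by_finite G \<longleftrightarrow>
     (\<exists>N. N \<lhd> G \<and> metabelian (G\<lparr>carrier := N\<rparr>) \<and> finite (carrier (G Mod N)))"

text \<open>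
  The regular wreath product of \<open>A\<close> by \<open>C\<close>: the base group consists of all functions from
  \<open>C\<close> to \<open>A\<close>, and \<open>C\<close> permutes the coordinates by translation.
\<close>

definition wreath :: "('a, 'c) monoid_scheme \<Rightarrow> ('b, 'd) monoid_scheme \<Rightarrow> (('b \<Rightarrow> 'a) \<times> 'b) monoid" where
  "wreath A C =
     \<lparr>carrier = (carrier C \<rightarrow>\<^sub>E carrier A) \<times> carrier C,
      monoid.mult = (\<lambda>(f, b) (g, c). (\<lambda>x\<in>carrier C. f x \<otimes>\<^bsub>A\<^esub> g (x \<otimes>\<^bsub>C\<^esub> b), b \<otimes>\<^bsub>C\<^esub> c)),
      one = (\<lambda>x\<in>carrier C. \<one>\<^bsub>A\<^esub>, \<one>\<^bsub>C\<^esub>)\<rparr>"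

definition homomorphic_image_of_subgroup ::
  "('a, 'c) monoid_scheme \<Rightarrow> ('b, 'd) monoid_scheme \<Rightarrow> bool" where
  "homomorphic_image_of_subgroup Q G \<longleftrightarrow> (\<exists>W. subgroup W G \<and> epi (G\<lparr>carrier := W\<rparr>) Q \<noteq> {})"

section \<open>The groups \<open>H\<close>, \<open>K\<close> and \<open>O\<close>\<close>

definition H_grp :: "nat \<Rightarrow> (nat list \<Rightarrow> nat list) \<Rightarrow> (nat list \<Rightarrow> nat list) set" where
  "H_grp n \<beta> = generate (aut_tree n) ({state n \<beta> (int i) | i. i < n} \<union> {adding_machine n})"

definition cycle_len :: "nat \<Rightarrow> int \<Rightarrow> nat" where
  "cycle_len n s = n div nat (gcd (int n) s)"

definition pi_prod :: "nat \<Rightarrow> int \<Rightarrow> (nat list \<Rightarrow> nat list) \<Rightarrow> nat \<Rightarrow> nat list \<Rightarrow> nat list" where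
  "pi_prod n s \<beta> i =
     foldr (monoid.mult (aut_tree n)) (map (\<lambda>k. state n \<beta> (int i + int k * s)) [0..<cycle_len n s])
       \<one>\<^bsub>aut_tree n\<^esub>"

definition K_grp :: "nat \<Rightarrow> int \<Rightarrow> (nat list \<Rightarrow> nat list) \<Rightarrow> (nat list \<Rightarrow> nat list) set" where
  "K_grp n s \<beta> = generate (aut_tree n)
     ({commutator (aut_tree n) (state n \<beta> (int i)) (adding_machine n [^]\<^bsub>aut_tree n\<^esub> k) | i (k :: int). i < n}
      \<union> {pi_prod n s \<beta> i | i. i < n})"

definition O_grp :: "nat \<Rightarrow> int \<Rightarrow> (nat list \<Rightarrow> nat list) \<Rightarrow> (nat list \<Rightarrow> nat list) set" where
  "O_grp n s \<beta> = K_grp n s \<beta> <#>\<^bsub>aut_tree n\<^esub> generate (aut_tree n) {adding_machine n}"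

section \<open>Basic facts\<close>

lemma Nil_in_words [simp]: "[] \<in> words n"
  and Cons_in_words [simp]: "i # u \<in> words n \<longleftrightarrow> i < n \<and> u \<in> words n"
  and append_in_words [simp]: "u @ v \<in> words n \<longleftrightarrow> u \<in> words n \<and> v \<in> words n"
  by (auto simp: words_def)

lemma group_aut_tree: "group (aut_tree n)"
proof (rule groupI)
  fix \<alpha> assume \<alpha>: "\<alpha> \<in> carrier (aut_tree n)"
  hence p: "\<alpha> permutes words n" by (simp add: aut_tree_def)
  have in_w: "inv_into UNIV \<alpha> u \<in> words n \<longleftrightarrow> u \<in> words n" for u
    using permutes_in_image[OF permutes_inv[OF p]] .
  have "tree_adj (inv_into UNIV \<alpha> u) (inv_into UNIV \<alpha> v) \<longleftrightarrow> tree_adj u v" if "u \<in> words n" "v \<in> words n" for u v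
  proof -
    have "tree_adj (\<alpha> (inv_into UNIV \<alpha> u)) (\<alpha> (inv_into UNIV \<alpha> v)) \<longleftrightarrow> tree_adj (inv_into UNIV \<alpha> u) (inv_into UNIV \<alpha> v)"
      using \<alpha> that by (simp add: aut_tree_def in_w)
    thus ?thesis by (simp add: permutes_inverses[OF p])
  qed
  moreover have "inv_into UNIV \<alpha> [] = []"
    using \<alpha> permutes_inverses(2)[OF p, of "[]"] by (simp add: aut_tree_def)
  ultimately have "inv_into UNIV \<alpha> \<in> carrier (aut_tree n)"
    using permutes_inv[OF p] by (simp add: aut_tree_def)
  moreover have "inv_into UNIV \<alpha> \<otimes>\<^bsub>aut_tree n\<^esub> \<alpha> = \<one>\<^bsub>aut_tree n\<^esub>"
    by (simp add: aut_tree_def permutes_inv_o[OF p])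
  ultimately show "\<exists>\<gamma>\<in>carrier (aut_tree n). \<gamma> \<otimes>\<^bsub>aut_tree n\<^esub> \<alpha> = \<one>\<^bsub>aut_tree n\<^esub>" by blast
qed (auto simp: aut_tree_def permutes_compose permutes_in_image comp_assoc)

lemma group_perm_group: "group (perm_group S)"
proof (rule groupI)
  fix p assume "p \<in> carrier (perm_group S)"
  thus "\<exists>q\<in>carrier (perm_group S). q \<otimes>\<^bsub>perm_group S\<^esub> p = \<one>\<^bsub>perm_group S\<^esub>"
    by (auto simp: perm_group_def permutes_inv_o intro!: bexI[of _ "inv_into UNIV p"] permutes_inv)
qed (auto simp: perm_group_def permutes_compose comp_assoc)

lemma aut_tree_snoc:
  assumes "\<alpha> \<in> carrier (aut_tree n)" "u @ [y] \<in> words n"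
  shows "\<exists>z<n. \<alpha> (u @ [y]) = \<alpha> u @ [z]"
  using assms(2)
proof (induction u arbitrary: y rule: rev_induct)
  have p: "\<alpha> permutes words n" and root: "\<alpha> [] = []"
    and adj: "\<And>u v. u \<in> words n \<Longrightarrow> v \<in> words n \<Longrightarrow> tree_adj (\<alpha> u) (\<alpha> v) \<longleftrightarrow> tree_adj u v"
    using assms(1) by (auto simp: aut_tree_def)
  { case Nil
    have "tree_adj (\<alpha> []) (\<alpha> [y])"
      using Nil by (subst adj) (auto simp: tree_adj_def)
    then obtain z where "\<alpha> [y] = [z]" by (auto simp: tree_adj_def root)
    thus ?case using Nil permutes_in_image[OF p, of "[y]"] by (auto simp: root)
  next
    case (snoc x v)
    have "tree_adj (\<alpha> (v @ [x])) (\<alpha> ((v @ [x]) @ [y]))"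
      using snoc.prems by (subst adj) (auto simp: tree_adj_def)
    then obtain z where "\<alpha> ((v @ [x]) @ [y]) = \<alpha> (v @ [x]) @ [z]
        \<or> \<alpha> (v @ [x]) = \<alpha> ((v @ [x]) @ [y]) @ [z]" by (auto simp: tree_adj_def)
    thus ?case
    proof
      assume e: "\<alpha> ((v @ [x]) @ [y]) = \<alpha> (v @ [x]) @ [z]"
      hence "\<alpha> (v @ [x]) @ [z] \<in> words n"
        using snoc.prems permutes_in_image[OF p] by metis
      with e show ?thesis by auto
    next
      assume "\<alpha> (v @ [x]) = \<alpha> ((v @ [x]) @ [y]) @ [z]"
      moreover obtain z' where "\<alpha> (v @ [x]) = \<alpha> v @ [z']"
        using snoc.IH[of x] snoc.prems by auto
      ultimately have "\<alpha> ((v @ [x]) @ [y]) = \<alpha> v" by simp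
      hence "(v @ [x]) @ [y] = v" using permutes_inj[OF p] by (auto dest: injD)
      thus ?thesis by simp
    qed
  }
qed

lemma aut_tree_Cons:
  assumes "\<alpha> \<in> carrier (aut_tree n)" "i < n" "u \<in> words n"
  shows "\<alpha> (i # u) = activity n \<alpha> i # state n \<alpha> (int i) u"
proof -
  have "\<alpha> (i # u) \<noteq> [] \<and> hd (\<alpha> (i # u)) = activity n \<alpha> i"
    using assms(3)
  proof (induction u rule: rev_induct)
    case Nil
    obtain z where "\<alpha> [i] = \<alpha> [] @ [z]"
      using aut_tree_snoc[OF assms(1), of "[]" i] assms(2) by auto
    thus ?case using assms(2) by (simp add: activity_def)
  next
    case (snoc y u)
    obtain z where "\<alpha> (i # u @ [y]) = \<alpha> (i # u) @ [z]"
      using aut_tree_snoc[OF assms(1), of "i # u" y] assms(2) snoc.prems by auto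
    thus ?case using snoc by auto
  qed
  thus ?thesis using assms(2,3) by (cases "\<alpha> (i # u)") (simp_all add: state_def)
qed

lemma activity_adding_machine: "activity n (adding_machine n) = sigma_tau n"
  by (auto simp: activity_def sigma_tau_def adding_machine_def fun_eq_iff)

lemma state_adding_machine:
  assumes "i < n"
  shows "state n (adding_machine n) (int i) = (if i = n - 1 then adding_machine n else id)"
proof -
  have "nat (int i mod int n) = i" using assms by simp
  hence "state n (adding_machine n) (int i) =
           (\<lambda>u. if u \<in> words n then tl (adding_machine n (i # u)) else u)"
    by (simp only: state_def)
  moreover have "i = n - 1 \<longleftrightarrow> i + 1 = n" using assms by auto
  ultimately show ?thesis using assms by (simp add: adding_machine_def fun_eq_iff)
qed

lemma group_wreath:
  assumes "group A" "group C"
  shows "group (wreath A C)"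
proof -
  interpret A: group A by fact
  interpret C: group C by fact
  let ?W = "wreath A C"
  have carr: "carrier ?W = (carrier C \<rightarrow>\<^sub>E carrier A) \<times> carrier C"
    and mult: "\<And>f b g c. (f, b) \<otimes>\<^bsub>?W\<^esub> (g, c) =
                 (\<lambda>x\<in>carrier C. f x \<otimes>\<^bsub>A\<^esub> g (x \<otimes>\<^bsub>C\<^esub> b), b \<otimes>\<^bsub>C\<^esub> c)"
    and one: "\<one>\<^bsub>?W\<^esub> = (\<lambda>x\<in>carrier C. \<one>\<^bsub>A\<^esub>, \<one>\<^bsub>C\<^esub>)"
    by (simp_all add: wreath_def)
  have val: "f x \<in> carrier A" if "f \<in> carrier C \<rightarrow>\<^sub>E carrier A" "x \<in> carrier C" for f x
    using that by (rule PiE_mem)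
  show ?thesis
  proof (rule groupI)
    show "\<one>\<^bsub>?W\<^esub> \<in> carrier ?W" by (simp add: carr one)
  next
    fix p q assume "p \<in> carrier ?W" "q \<in> carrier ?W"
    thus "p \<otimes>\<^bsub>?W\<^esub> q \<in> carrier ?W"
      by (cases p; cases q) (simp add: carr mult val)
  next
    fix p q r assume "p \<in> carrier ?W" "q \<in> carrier ?W" "r \<in> carrier ?W"
    thus "p \<otimes>\<^bsub>?W\<^esub> q \<otimes>\<^bsub>?W\<^esub> r = p \<otimes>\<^bsub>?W\<^esub> (q \<otimes>\<^bsub>?W\<^esub> r)"
      by (cases p; cases q; cases r)
        (simp add: carr mult val A.m_assoc C.m_assoc cong: restrict_cong)
  next
    fix p assume "p \<in> carrier ?W"
    thus "\<one>\<^bsub>?W\<^esub> \<otimes>\<^bsub>?W\<^esub> p = p"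
      by (cases p) (auto simp: carr mult one val PiE_iff extensional_def fun_eq_iff)
  next
    fix p assume p: "p \<in> carrier ?W"
    obtain f b where fb: "p = (f, b)" by force
    have f: "f \<in> carrier C \<rightarrow>\<^sub>E carrier A" and b: "b \<in> carrier C"
      using p by (auto simp: fb carr)
    let ?q = "(\<lambda>x\<in>carrier C. inv\<^bsub>A\<^esub> f (x \<otimes>\<^bsub>C\<^esub> inv\<^bsub>C\<^esub> b), inv\<^bsub>C\<^esub> b)"
    have "?q \<in> carrier ?W" using b by (simp add: carr val[OF f])
    moreover have "?q \<otimes>\<^bsub>?W\<^esub> p = \<one>\<^bsub>?W\<^esub>"
      using b by (simp add: fb mult one val[OF f] cong: restrict_cong)
    ultimately show "\<exists>q\<in>carrier ?W. q \<otimes>\<^bsub>?W\<^esub> p = \<one>\<^bsub>?W\<^esub>" by blast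
  qed
qed

lemma card_wreath_integer_mod_group:
  assumes "m > 0" "n > 0"
  shows "card (carrier (wreath (integer_mod_group m) (integer_mod_group n))) = m ^ n * n"
  using assms by (simp add: wreath_def card_cartesian_product card_PiE carrier_integer_mod_group)

end

theory Submission
  imports Defs "HOL-Algebra.SndIsomorphismGrp"
begin

text \<open>
  The proof replaces the states of \<open>\<beta>\<close> by elements indexed by all integers, for which the
  commutation of \<open>\<beta>\<close> with its conjugates becomes one symmetric relation.

  Write \<open>[j, u]\<close>, for an integer \<open>j\<close> and a word \<open>u\<close>, for the vertex whose first letter is
  \<open>j mod n\<close> and whose remainder is the image of \<open>u\<close> under \<open>\<tau>\<close> to the power \<open>j div n\<close>
  (\<open>lift\<close>).  In these coordinates \<open>\<tau>\<close> is the translation \<open>[j, u] \<mapsto> [j + 1, u]\<close>.  If the activity of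
  \<open>\<beta>\<close> moves \<open>j mod n\<close> to \<open>(j + \<epsilon> j) mod n\<close>, then \<open>\<beta>\<close> is \<open>[j, u] \<mapsto> [j + \<epsilon> j, u b\<^sub>j]\<close>, where \<open>b\<^sub>j\<close> is
  the state of \<open>\<beta>\<close> at \<open>j\<close> multiplied on both sides by powers of \<open>\<tau>\<close> (\<open>coord\<close>).  The conjugate of
  \<open>\<beta>\<close> by \<open>\<tau>\<close> to the power \<open>k\<close> is given by the elements \<open>b\<^sub>j\<^sub>-\<^sub>k\<close>, it lies in \<open>B\<close>, and so it
  commutes with \<open>\<beta>\<close>.  When \<open>\<epsilon>\<close> is \<open>s\<close> on a set \<open>E\<close> of integers that is invariant under translation
  by \<open>s\<close>, and \<open>0\<close> outside \<open>E\<close>, this says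
  \<open>b\<^sub>j b\<^bsub>l + \<epsilon> j\<^esub> = b\<^sub>l b\<^bsub>j + \<epsilon> l\<^esub>\<close> for all integers \<open>j\<close> and \<open>l\<close>
  (\<open>twisted_family_coord\<close>).  Moreover conjugation by \<open>\<tau>\<close> shifts the family by \<open>n\<close>, and \<open>H\<close> is
  generated by the \<open>b\<^sub>j\<close> and \<open>\<tau>\<close>.

  For \<open>i\<close>, \<open>j\<close> in \<open>E\<close> the relation reads \<open>b\<^sub>j\<^sup>-\<^sup>1 b\<^sub>i = b\<^bsub>i + s\<^esub> b\<^bsub>j + s\<^esub>\<^sup>-\<^sup>1\<close>.  It follows that every \<open>b\<^sub>k\<close>
  with \<open>k\<close> in \<open>E\<close> conjugates \<open>b\<^sub>j\<^sup>-\<^sup>1 b\<^sub>i\<close> to \<open>b\<^bsub>j + s\<^esub>\<^sup>-\<^sup>1 b\<^bsub>i + s\<^esub>\<close>, independently of \<open>k\<close>; hence these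
  quotients commute with each other.  Together with the \<open>b\<^sub>l\<close> for \<open>l\<close> outside \<open>E\<close> they generate an
  abelian normal subgroup of \<open>H\<close> with abelian quotient (\<open>metabelian_family\<close>).  So \<open>H\<close> is metabelian, and in
  particular metabelian-by-finite, if \<open>\<sigma>\<^sub>\<beta>\<close> is a power of \<open>\<sigma>\<^sub>\<tau>\<close> (take \<open>E\<close> to be all integers).  If
  \<open>\<sigma>\<^sub>\<beta>\<close> is a transposition, commutation of \<open>\<beta>\<close> with a conjugate forces the two letters to differ by \<open>n/2\<close>
  modulo \<open>n\<close>, and \<open>E\<close> is a residue class modulo \<open>s = n/2\<close>.

  For the series in the first part, \<open>\<epsilon>\<close> is constantly \<open>s\<close>.  The relation then means that
  \<open>b\<^bsub>x\<^sub>0\<^esub> b\<^bsub>x\<^sub>1 + s\<^esub> b\<^bsub>x\<^sub>2 + 2s\<^esub> \<dots>\<close> depends only on the multiset of the \<open>x\<^sub>r\<close>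
  (\<open>word_cong_mset\<close>).  For \<open>0 \<le> i < n\<close> the element \<open>\<pi>\<^sub>i\<close> is the product of
  \<open>b\<^sub>i, b\<^bsub>i + s\<^esub>, \<dots>, b\<^bsub>i + (m-1)s\<^esub>\<close> and a power of \<open>\<tau>\<close> that does not depend on \<open>i\<close>.  Extending this
  to all integers \<open>i\<close> and permuting the factors shows that the \<open>\<pi>\<^sub>i\<close> commute, that they centralize
  the quotients above, and that the \<open>b\<^sub>k\<close> permute them by conjugation.  This gives that \<open>K\<close> is
  abelian and that \<open>K\<close> and \<open>O\<close> are normal in \<open>H\<close>.

  Finally, let \<open>g\<^sub>i\<close> be the image of \<open>b\<^sub>i\<close> in \<open>H/O\<close>.  It depends only on \<open>i mod n\<close>, and
  \<open>g\<^sub>i g\<^bsub>i + s\<^esub> \<dots> g\<^bsub>i + (m-1)s\<^esub> = 1\<close>.  In the wreath product, the elements \<open>(\<delta>\<^sub>i, s)\<close> satisfy the same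
  relations, and the base component of a product of them counts modulo \<open>m\<close> the letters of the word.  So a word that
  is trivial there can be rearranged into blocks of \<open>m\<close> equal letters, and is trivial in \<open>H/O\<close> too.
  Hence \<open>(\<delta>\<^sub>i, s) \<mapsto> g\<^sub>i\<close> extends to a homomorphism from the subgroup generated by the \<open>(\<delta>\<^sub>i, s)\<close> onto
  \<open>H/O\<close> (\<open>homomorphic_image_of_wreath_subgroup\<close>).
\<close>

section \<open>Generated subgroups\<close>

context group
begin

lemma inv_mult_cancel: "x \<in> carrier G \<Longrightarrow> y \<in> carrier G \<Longrightarrow> inv x \<otimes> (x \<otimes> y) = y"
  by (simp add: m_assoc[symmetric])

lemma mult_inv_cancel: "x \<in> carrier G \<Longrightarrow> y \<in> carrier G \<Longrightarrow> x \<otimes> (inv x \<otimes> y) = y"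
  by (simp add: m_assoc[symmetric])

lemma inv_commute:
  assumes "a \<otimes> x = x \<otimes> a" "a \<in> carrier G" "x \<in> carrier G"
  shows "a \<otimes> inv x = inv x \<otimes> a"
proof -
  have "inv x \<otimes> (a \<otimes> x) \<otimes> inv x = inv x \<otimes> (x \<otimes> a) \<otimes> inv x" using assms(1) by simp
  thus ?thesis using assms(2,3) by (simp add: m_assoc inv_mult_cancel)
qed

lemma conj_eqI:
  assumes "y \<otimes> x = x \<otimes> z" "x \<in> carrier G" "y \<in> carrier G" "z \<in> carrier G"
  shows "inv x \<otimes> y \<otimes> x = z" and "x \<otimes> z \<otimes> inv x = y"
  subgoal using assms by (simp add: m_assoc inv_mult_cancel)
  subgoal unfolding assms(1)[symmetric] using assms(2-4) by (simp add: m_assoc)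
  done

lemma commute_mult_inv:
  assumes "x \<otimes> y = y \<otimes> z" "x \<otimes> y' = y' \<otimes> z"
    and "x \<in> carrier G" "y \<in> carrier G" "y' \<in> carrier G" "z \<in> carrier G"
  shows "x \<otimes> (y \<otimes> inv y') = y \<otimes> inv y' \<otimes> x"
proof -
  have "z \<otimes> inv y' = inv y' \<otimes> (x \<otimes> y') \<otimes> inv y'"
    using assms(2-6) by (simp add: inv_mult_cancel m_assoc)
  hence "z \<otimes> inv y' = inv y' \<otimes> x" using assms(3-6) by (simp add: m_assoc)
  thus ?thesis using assms by (simp add: m_assoc[symmetric]) (simp add: m_assoc)
qed

lemma generate_commute:
  assumes S: "S \<subseteq> carrier G" and a: "a \<in> carrier G"
    and comm: "\<And>x. x \<in> S \<Longrightarrow> a \<otimes> x = x \<otimes> a"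
    and y: "y \<in> generate G S"
  shows "a \<otimes> y = y \<otimes> a"
  using y
proof induction
  case (eng h1 h2)
  have c: "h1 \<in> carrier G" "h2 \<in> carrier G" using eng.hyps generate_in_carrier[OF S] by auto
  have "a \<otimes> (h1 \<otimes> h2) = h1 \<otimes> (a \<otimes> h2)" using c a eng.IH(1) by (simp add: m_assoc[symmetric])
  also have "\<dots> = h1 \<otimes> h2 \<otimes> a" using c a eng.IH(2) by (simp add: m_assoc)
  finally show ?case .
qed (use S a comm inv_commute in auto)

lemma comm_group_subgroupI:
  assumes "subgroup N G" "\<And>x y. x \<in> N \<Longrightarrow> y \<in> N \<Longrightarrow> x \<otimes> y = y \<otimes> x"
  shows "comm_group (G\<lparr>carrier := N\<rparr>)"
  by (rule group.group_comm_groupI[OF subgroup_imp_group[OF assms(1)]]) (use assms(2) in simp)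

lemma generate_commuting:
  assumes S: "S \<subseteq> carrier G" and comm: "\<And>x y. x \<in> S \<Longrightarrow> y \<in> S \<Longrightarrow> x \<otimes> y = y \<otimes> x"
    and x: "x \<in> generate G S" and y: "y \<in> generate G S"
  shows "x \<otimes> y = y \<otimes> x"
proof (rule generate_commute[OF S _ _ y])
  show "x \<in> carrier G" using x generate_in_carrier[OF S] by auto
  fix z assume z: "z \<in> S"
  show "x \<otimes> z = z \<otimes> x" using generate_commute[OF S _ comm x, of z] z S by auto
qed

lemma generate_conj_closed:
  assumes S: "S \<subseteq> carrier G" and x: "x \<in> carrier G"
    and conj: "\<And>s. s \<in> S \<Longrightarrow> x \<otimes> s \<otimes> inv x \<in> generate G S"
    and h: "h \<in> generate G S"
  shows "x \<otimes> h \<otimes> inv x \<in> generate G S"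
  using h
proof induction
  case one
  show ?case using x by (simp add: generate.one)
next
  case (inv h)
  have "inv (x \<otimes> h \<otimes> inv x) \<in> generate G S" using generate_m_inv_closed[OF S conj[OF inv]] .
  moreover have "inv (x \<otimes> h \<otimes> inv x) = x \<otimes> inv h \<otimes> inv x"
    using inv S x by (auto simp: inv_mult_group m_assoc)
  ultimately show ?case by simp
next
  case (eng h1 h2)
  have c: "h1 \<in> carrier G" "h2 \<in> carrier G" using eng.hyps generate_in_carrier[OF S] by auto
  have "x \<otimes> (h1 \<otimes> h2) \<otimes> inv x = (x \<otimes> h1 \<otimes> inv x) \<otimes> (x \<otimes> h2 \<otimes> inv x)"
    using x c by (simp add: m_assoc inv_mult_cancel)
  thus ?case using eng.IH by (simp add: generate.eng)
qed (use conj in auto)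

lemma generate_normal_in_generate:
  assumes X: "X \<subseteq> carrier G" and S: "S \<subseteq> generate G X"
    and conj: "\<And>x s. x \<in> X \<Longrightarrow> s \<in> S \<Longrightarrow> x \<otimes> s \<otimes> inv x \<in> generate G S"
    and conj': "\<And>x s. x \<in> X \<Longrightarrow> s \<in> S \<Longrightarrow> inv x \<otimes> s \<otimes> x \<in> generate G S"
  shows "generate G S \<lhd> G\<lparr>carrier := generate G X\<rparr>"
proof -
  have sX: "subgroup (generate G X) G" by (rule generate_is_subgroup[OF X])
  interpret H: group "G\<lparr>carrier := generate G X\<rparr>" by (rule subgroup_imp_group[OF sX])
  have SG: "S \<subseteq> carrier G" using S generate_incl[OF X] by auto
  have sS: "subgroup (generate G S) (G\<lparr>carrier := generate G X\<rparr>)"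
    using generate_subgroup_incl[OF S sX] generate_is_subgroup[OF SG] sX
    by (intro subgroup_incl) auto
  have "x \<otimes> h \<otimes> inv x \<in> generate G S" if "x \<in> generate G X" "h \<in> generate G S" for x h
    using that
  proof (induction arbitrary: h)
    case one
    thus ?case using generate_in_carrier[OF SG] by auto
  next
    case (incl x)
    show ?case by (rule generate_conj_closed[OF SG _ conj]) (use incl X in auto)
  next
    case (inv x)
    have "inv x \<otimes> h \<otimes> inv (inv x) \<in> generate G S"
      by (rule generate_conj_closed[OF SG]) (use inv X conj'[of x] in auto)
    thus ?case .
  next
    case (eng x y)
    have c: "x \<in> carrier G" "y \<in> carrier G" "h \<in> carrier G"
      using eng.hyps eng.prems generate_in_carrier[OF X] generate_in_carrier[OF SG] by auto
    have "x \<otimes> y \<otimes> h \<otimes> inv (x \<otimes> y) = x \<otimes> (y \<otimes> h \<otimes> inv y) \<otimes> inv x"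
      using c by (simp add: m_assoc inv_mult_group)
    thus ?case using eng by simp
  qed
  thus ?thesis
    using sS m_inv_consistent[OF sX] by (auto simp: H.normal_inv_iff)
qed

text \<open>
  A group is metabelian as soon as it has an abelian normal subgroup modulo which its generators
  commute.
\<close>

lemma metabelian_generateI:
  assumes X: "X \<subseteq> carrier G" and N: "N \<lhd> G\<lparr>carrier := generate G X\<rparr>"
    and comm: "\<And>x y. x \<in> N \<Longrightarrow> y \<in> N \<Longrightarrow> x \<otimes> y = y \<otimes> x"
    and quot: "\<And>x y. x \<in> X \<Longrightarrow> y \<in> X \<Longrightarrow> \<exists>\<nu>\<in>N. x \<otimes> y = y \<otimes> x \<otimes> \<nu>"
  shows "metabelian (G\<lparr>carrier := generate G X\<rparr>)"
proof -
  define H where "H = G\<lparr>carrier := generate G X\<rparr>"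
  have sX: "subgroup (generate G X) G" by (rule generate_is_subgroup[OF X])
  interpret H: group H unfolding H_def by (rule subgroup_imp_group[OF sX])
  interpret N: normal N H using N by (simp add: H_def)
  interpret Q: group "H Mod N" by (rule N.factorgroup_is_group)
  define \<pi> where "\<pi> = (\<lambda>a. N #>\<^bsub>H\<^esub> a)"
  interpret \<pi>: group_hom H "H Mod N" \<pi>
    unfolding \<pi>_def by unfold_locales (rule N.r_coset_hom_Mod)
  have XH: "X \<subseteq> carrier H" by (auto simp: H_def generate.incl)
  have HX: "carrier H = generate H X"
    using generate_consistent[OF _ sX, of X] XH by (simp add: H_def)
  have "\<pi> x \<otimes>\<^bsub>H Mod N\<^esub> \<pi> y = \<pi> y \<otimes>\<^bsub>H Mod N\<^esub> \<pi> x" if xy: "x \<in> X" "y \<in> X" for x y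
  proof -
    obtain \<nu> where \<nu>: "\<nu> \<in> N" "x \<otimes>\<^bsub>H\<^esub> y = y \<otimes>\<^bsub>H\<^esub> x \<otimes>\<^bsub>H\<^esub> \<nu>" using quot[OF xy] by (auto simp: H_def)
    have c: "x \<in> carrier H" "y \<in> carrier H" using xy XH by auto
    have "\<pi> \<nu> = \<one>\<^bsub>H Mod N\<^esub>"
      unfolding \<pi>_def using \<nu>(1) by (simp add: H.coset_join2 N.mem_carrier N.subgroup_axioms)
    hence "\<pi> (x \<otimes>\<^bsub>H\<^esub> y) = \<pi> (y \<otimes>\<^bsub>H\<^esub> x)" unfolding \<nu>(2) using c \<nu>(1)
      by (simp del: mult_FactGroup one_FactGroup)
    thus ?thesis using c by (simp del: mult_FactGroup)
  qed
  hence cc: "a \<otimes>\<^bsub>H Mod N\<^esub> b = b \<otimes>\<^bsub>H Mod N\<^esub> a"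
    if "a \<in> generate (H Mod N) (\<pi> ` X)" "b \<in> generate (H Mod N) (\<pi> ` X)" for a b
    by (intro Q.generate_commuting[OF _ _ that]) (use XH in auto)
  have img: "generate (H Mod N) (\<pi> ` X) = carrier (H Mod N)"
    using \<pi>.generate_img[OF XH] HX by (simp add: carrier_FactGroup \<pi>_def)
  have commQ: "comm_group (H Mod N)"
    by (rule Q.group_comm_groupI) (use cc img in auto)
  have "\<pi> ` derived H (carrier H) = derived (H Mod N) (\<pi> ` carrier H)"
    by (rule \<pi>.derived_img[symmetric]) simp
  also have "\<dots> = {\<one>\<^bsub>H Mod N\<^esub>}"
    by (rule comm_group.derived_eq_singleton[OF commQ]) auto
  finally have \<pi>_der: "\<pi> ` derived H (carrier H) = {\<one>\<^bsub>H Mod N\<^esub>}" .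
  have sub: "h \<in> N" if h: "h \<in> derived H (carrier H)" for h
  proof (rule H.coset_join1[OF _ _ N.subgroup_axioms])
    show "h \<in> carrier H" using h H.derived_in_carrier[of "carrier H"] by auto
    have "\<pi> h \<in> {\<one>\<^bsub>H Mod N\<^esub>}" using h unfolding \<pi>_der[symmetric] by (rule imageI)
    thus "N #>\<^bsub>H\<^esub> h = N" by (simp add: \<pi>_def)
  qed
  have "comm_group (H\<lparr>carrier := derived H (carrier H)\<rparr>)"
    by (rule H.comm_group_subgroupI[OF H.derived_is_subgroup]) (use sub comm in \<open>auto simp: H_def\<close>)
  thus ?thesis unfolding metabelian_def H_def using H.group_axioms by (simp add: H_def)
qed

end

section \<open>Twisted commuting families\<close>

text \<open>
  The relation satisfied by the coordinates of an automorphism that commutes with all its conjugates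
  by powers of \<open>\<tau>\<close>: indices in \<open>E\<close> are moved by \<open>s\<close>, the others are fixed.
\<close>

locale twisted_family = group G for G (structure) +
  fixes b :: "int \<Rightarrow> 'a" and E :: "int set" and s :: int
  assumes b_closed [simp, intro]: "b j \<in> carrier G"
    and E_shift: "j + s \<in> E \<longleftrightarrow> j \<in> E"
    and twist: "b j \<otimes> b (l + (if j \<in> E then s else 0)) = b l \<otimes> b (j + (if l \<in> E then s else 0))"
begin

text \<open>The quotient \<open>b\<^sub>j\<^sup>-\<^sup>1 b\<^sub>i\<close> of two members of the family.\<close>

definition d :: "int \<Rightarrow> int \<Rightarrow> 'a" where
  "d i j = inv (b j) \<otimes> b i"

lemma d_closed [simp, intro]: "d i j \<in> carrier G"
  by (simp add: d_def)

lemma twist_in: "i \<in> E \<Longrightarrow> j \<in> E \<Longrightarrow> b i \<otimes> b (j + s) = b j \<otimes> b (i + s)"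
  using twist[of i j] by simp

lemma d_alt:
  assumes "i \<in> E" "j \<in> E"
  shows "d i j = b (i + s) \<otimes> inv (b (j + s))"
proof -
  have "inv (b j) \<otimes> (b i \<otimes> b (j + s)) \<otimes> inv (b (j + s))
      = inv (b j) \<otimes> (b j \<otimes> b (i + s)) \<otimes> inv (b (j + s))" using twist_in[OF assms] by simp
  thus ?thesis by (simp add: d_def m_assoc inv_mult_cancel)
qed

text \<open>
  Conjugation by \<open>b k\<close> shifts both indices of \<open>d i j\<close> by \<open>s\<close>, whatever \<open>k\<close> is.  Since \<open>d k l\<close> is
  also \<open>b (k + s) \<otimes> inv (b (l + s))\<close>, two such quotients therefore commute.
\<close>

lemma d_mult_b:
  assumes "i \<in> E" "j \<in> E" "k \<in> E"
  shows "d i j \<otimes> b k = b k \<otimes> d (i + s) (j + s)"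
proof -
  define l where "l = k - s"
  have l: "l \<in> E" "k = l + s" using assms(3) E_shift[of l] by (auto simp: l_def)
  have "d i j = d l j \<otimes> d i l" by (simp add: d_def m_assoc mult_inv_cancel)
  also have "\<dots> = b k \<otimes> inv (b (j + s)) \<otimes> (b (i + s) \<otimes> inv (b k))"
    using assms l by (simp add: d_alt)
  finally have "d i j \<otimes> b k = b k \<otimes> inv (b (j + s)) \<otimes> (b (i + s) \<otimes> inv (b k)) \<otimes> b k" by simp
  thus ?thesis by (simp add: m_assoc d_def)
qed

lemma d_commute:
  assumes "i \<in> E" "j \<in> E" "k \<in> E" "l \<in> E"
  shows "d i j \<otimes> d k l = d k l \<otimes> d i j"
  unfolding d_alt[OF assms(3,4)]
  by (rule commute_mult_inv[where z = "d (i + s) (j + s)"])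
    (use assms in \<open>auto simp: d_mult_b E_shift\<close>)

lemma b_outside_commute:
  assumes "i \<notin> E" "j \<notin> E"
  shows "b i \<otimes> b j = b j \<otimes> b i"
  using twist[of i j] assms by simp

lemma b_outside_mult_b:
  assumes "l \<notin> E" "j \<in> E"
  shows "b l \<otimes> b j = b j \<otimes> b (l + s)"
  using twist[of j l] assms by simp

lemma b_outside_commute_d:
  assumes "l \<notin> E" "i \<in> E" "j \<in> E"
  shows "b l \<otimes> d i j = d i j \<otimes> b l"
  unfolding d_alt[OF assms(2,3)]
  by (rule commute_mult_inv[where z = "b (l + s)"])
    (use assms in \<open>auto simp: b_outside_mult_b E_shift\<close>)

text \<open>Generators of an abelian normal subgroup with abelian quotient.\<close>

definition A_gens :: "'a set" where
  "A_gens = {d i j | i j. i \<in> E \<and> j \<in> E} \<union> {b l | l. l \<notin> E}"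

lemma A_gens_closed: "A_gens \<subseteq> carrier G"
  by (auto simp: A_gens_def)

lemma A_gens_commute: "x \<in> A_gens \<Longrightarrow> y \<in> A_gens \<Longrightarrow> x \<otimes> y = y \<otimes> x"
  using d_commute b_outside_commute b_outside_commute_d
  by (auto simp: A_gens_def)

lemma d_in_A: "i \<in> E \<Longrightarrow> j \<in> E \<Longrightarrow> d i j \<in> generate G A_gens"
  by (rule generate.incl) (auto simp: A_gens_def)

lemma b_in_A: "l \<notin> E \<Longrightarrow> b l \<in> generate G A_gens"
  by (rule generate.incl) (auto simp: A_gens_def)

lemma A_conj_b:
  assumes "x \<in> A_gens"
  shows "b k \<otimes> x \<otimes> inv (b k) \<in> generate G A_gens" (is ?left)
    and "inv (b k) \<otimes> x \<otimes> b k \<in> generate G A_gens" (is ?right)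
proof -
  have "?left \<and> ?right"
  proof (cases "k \<in> E")
    case k: True
    from assms consider i j where "x = d i j" "i \<in> E" "j \<in> E" | l where "x = b l" "l \<notin> E"
      by (auto simp: A_gens_def)
    thus ?thesis
    proof cases
      case 1
      have E: "i - s \<in> E" "j - s \<in> E" "i + s \<in> E" "j + s \<in> E"
        using E_shift[of "i - s"] E_shift[of "j - s"] E_shift[of i] E_shift[of j] 1 by auto
      have "x \<otimes> b k = b k \<otimes> d (i + s) (j + s)" using d_mult_b[of i j k] 1 k by simp
      moreover have "d (i - s) (j - s) \<otimes> b k = b k \<otimes> x"
        using d_mult_b[OF E(1,2) k] 1 by simp
      ultimately show ?thesis
        using conj_eqI(1)[of x "b k" "d (i + s) (j + s)"] conj_eqI(2)[of "d (i - s) (j - s)" "b k" x]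
          d_in_A[OF E(1,2)] d_in_A[OF E(3,4)] 1(1) by auto
    next
      case 2
      have E: "l - s \<notin> E" "l + s \<notin> E" using E_shift[of "l - s"] E_shift[of l] 2 by auto
      have "x \<otimes> b k = b k \<otimes> b (l + s)" using b_outside_mult_b[of l k] 2 k by simp
      moreover have "b (l - s) \<otimes> b k = b k \<otimes> x" using b_outside_mult_b[OF E(1) k] 2 by simp
      ultimately show ?thesis
        using conj_eqI(1)[of x "b k" "b (l + s)"] conj_eqI(2)[of "b (l - s)" "b k" x]
          b_in_A[OF E(1)] b_in_A[OF E(2)] 2(1) by auto
    qed
  next
    case False
    have x: "x \<in> generate G A_gens" "x \<in> carrier G" using assms A_gens_closed by (auto intro: generate.incl)
    have "x \<otimes> b k = b k \<otimes> x" using assms False by (intro A_gens_commute) (auto simp: A_gens_def)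
    from conj_eqI[OF this] x show ?thesis by auto
  qed
  thus ?left ?right by auto
qed

text \<open>
  Modulo the subgroup generated by \<open>A_gens\<close>, all \<open>b j\<close> with \<open>j\<close> in \<open>E\<close> agree and the other \<open>b l\<close>
  vanish; as \<open>t\<close> permutes the family by conjugation and preserves \<open>E\<close>, it commutes with the family
  modulo this subgroup.
\<close>

lemma metabelian_family:
  assumes t: "t \<in> carrier G" and E_n: "\<And>j. j + n \<in> E \<longleftrightarrow> j \<in> E"
    and t_b: "\<And>j. t \<otimes> b j = b (j + n) \<otimes> t"
  shows "metabelian (G\<lparr>carrier := generate G (range b \<union> {t})\<rparr>)"
proof (rule metabelian_generateI)
  let ?X = "range b \<union> {t}" and ?A = "generate G A_gens"
  show X: "?X \<subseteq> carrier G" using t by auto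
  have b_t: "b j \<in> generate G ?X" for j by (rule generate.incl) auto
  have d_t: "d i j \<in> generate G ?X" for i j
    unfolding d_def by (intro generate.eng generate_m_inv_closed[OF X] b_t)
  have t_conj: "t \<otimes> b j \<otimes> inv t = b (j + n)" for j
    using t by (simp add: t_b m_assoc)
  have t_conj_inv: "t \<otimes> inv (b j) \<otimes> inv t = inv (b (j + n))" for j
    unfolding t_conj[symmetric] using t by (simp add: inv_mult_group m_assoc)
  have t_d: "t \<otimes> d i j = d (i + n) (j + n) \<otimes> t" for i j
  proof -
    have "t \<otimes> d i j = (t \<otimes> inv (b j) \<otimes> inv t) \<otimes> (t \<otimes> b i)"
      using t by (simp add: d_def m_assoc inv_mult_cancel)
    thus ?thesis unfolding t_conj_inv t_b using t by (simp add: d_def m_assoc)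
  qed
  show "?A \<lhd> G\<lparr>carrier := generate G ?X\<rparr>"
  proof (rule generate_normal_in_generate[OF X])
    show "A_gens \<subseteq> generate G ?X" using b_t d_t by (auto simp: A_gens_def)
    fix x a assume x: "x \<in> ?X" and a: "a \<in> A_gens"
    have "t \<otimes> a \<otimes> inv t \<in> ?A \<and> inv t \<otimes> a \<otimes> t \<in> ?A"
    proof -
      from a consider i j where "a = d i j" "i \<in> E" "j \<in> E" | l where "a = b l" "l \<notin> E"
        by (auto simp: A_gens_def)
      thus ?thesis
      proof cases
        case 1
        have E: "i - n \<in> E" "j - n \<in> E" "i + n \<in> E" "j + n \<in> E"
          using E_n[of "i - n"] E_n[of "j - n"] E_n[of i] E_n[of j] 1 by auto
        have "d (i + n) (j + n) \<otimes> t = t \<otimes> a" using t_d[of i j] 1 by simp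
        moreover have "a \<otimes> t = t \<otimes> d (i - n) (j - n)" using t_d[of "i - n" "j - n"] 1 by simp
        ultimately show ?thesis
          using conj_eqI(2)[of "d (i + n) (j + n)" t a] conj_eqI(1)[of a t "d (i - n) (j - n)"]
            d_in_A[OF E(1,2)] d_in_A[OF E(3,4)] 1(1) t by auto
      next
        case 2
        have E: "l - n \<notin> E" "l + n \<notin> E" using E_n[of "l - n"] E_n[of l] 2 by auto
        have "b (l + n) \<otimes> t = t \<otimes> a" using t_b[of l] 2 by simp
        moreover have "a \<otimes> t = t \<otimes> b (l - n)" using t_b[of "l - n"] 2 by simp
        ultimately show ?thesis
          using conj_eqI(2)[of "b (l + n)" t a] conj_eqI(1)[of a t "b (l - n)"]
            b_in_A[OF E(1)] b_in_A[OF E(2)] 2(1) t by auto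
      qed
    qed
    thus "x \<otimes> a \<otimes> inv x \<in> ?A" "inv x \<otimes> a \<otimes> x \<in> ?A"
      using x A_conj_b[OF a] by auto
  qed
  show "x \<otimes> y = y \<otimes> x" if "x \<in> ?A" "y \<in> ?A" for x y
    using generate_commuting[OF A_gens_closed A_gens_commute that] .
  have swap: "\<exists>\<nu>\<in>?A. y \<otimes> x = x \<otimes> y \<otimes> \<nu>"
    if "\<exists>\<nu>\<in>?A. x \<otimes> y = y \<otimes> x \<otimes> \<nu>" "x \<in> carrier G" "y \<in> carrier G" for x y
  proof -
    obtain \<nu> where \<nu>: "\<nu> \<in> ?A" "x \<otimes> y = y \<otimes> x \<otimes> \<nu>" using \<open>\<exists>\<nu>\<in>?A. _\<close> by blast
    have "\<nu> \<in> carrier G" using \<nu>(1) generate_in_carrier[OF A_gens_closed] by blast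
    hence "y \<otimes> x = x \<otimes> y \<otimes> inv \<nu>" using that(2,3) by (simp add: \<nu>(2) m_assoc)
    thus ?thesis using generate_m_inv_closed[OF A_gens_closed \<nu>(1)] by blast
  qed
  have by_inv: "\<exists>\<nu>\<in>?A. z = y \<otimes> x \<otimes> \<nu>"
    if "z = y \<otimes> x'" "inv x \<otimes> x' \<in> ?A" "x \<in> carrier G" "y \<in> carrier G" "x' \<in> carrier G" for x x' y z
    using that by (intro bexI[of _ "inv x \<otimes> x'"]) (simp_all add: m_assoc mult_inv_cancel)
  have b_diff: "inv (b i) \<otimes> b j \<in> ?A" if "i \<in> E \<longleftrightarrow> j \<in> E" for i j
  proof (cases "j \<in> E")
    case True
    thus ?thesis using that d_in_A[of j i] by (simp add: d_def)
  next
    case False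
    thus ?thesis using that by (intro generate.eng generate_m_inv_closed[OF A_gens_closed] b_in_A) auto
  qed
  have out: "\<exists>\<nu>\<in>?A. b i \<otimes> b j = b j \<otimes> b i \<otimes> \<nu>" if "i \<notin> E" "j \<in> E" for i j
    by (rule by_inv[OF b_outside_mult_b[OF that] b_diff]) (use E_shift in auto)
  have bb: "\<exists>\<nu>\<in>?A. b i \<otimes> b j = b j \<otimes> b i \<otimes> \<nu>" for i j
  proof -
    consider "i \<in> E" "j \<in> E" | "i \<notin> E" "j \<notin> E" | "i \<notin> E" "j \<in> E" | "i \<in> E" "j \<notin> E" by blast
    thus ?thesis
    proof cases
      case 1
      \<comment> \<open>Write \<open>b i\<close> as \<open>b j \<otimes> d i j\<close> and move \<open>d i j\<close> past \<open>b j\<close>, which shifts its indices.\<close>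
      have "b i \<otimes> b j = b j \<otimes> (d i j \<otimes> b j)" by (simp add: d_def m_assoc mult_inv_cancel)
      also have "d i j \<otimes> b j = b j \<otimes> d (i + s) (j + s)" by (rule d_mult_b) (use 1 in auto)
      finally show ?thesis
      proof (rule by_inv)
        have "inv (b i) \<otimes> (b j \<otimes> d (i + s) (j + s)) = d j i \<otimes> d (i + s) (j + s)"
          by (simp add: d_def m_assoc)
        thus "inv (b i) \<otimes> (b j \<otimes> d (i + s) (j + s)) \<in> ?A"
          using 1 by (simp add: generate.eng d_in_A E_shift)
      qed auto
    next
      case 2
      thus ?thesis by (intro bexI[of _ \<one>]) (auto simp: b_outside_commute generate.one)
    next
      case 3
      thus ?thesis by (rule out)
    next
      case 4
      show ?thesis by (rule swap[OF out]) (use 4 in auto)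
    qed
  qed
  have bt: "\<exists>\<nu>\<in>?A. t \<otimes> b j = b j \<otimes> t \<otimes> \<nu>" for j
  proof (rule swap)
    have "b j \<otimes> t = t \<otimes> b (j - n)" using t_b[of "j - n"] by simp
    thus "\<exists>\<nu>\<in>?A. b j \<otimes> t = t \<otimes> b j \<otimes> \<nu>"
      by (rule by_inv) (use t E_n[of "j - n"] in \<open>auto intro: b_diff\<close>)
  qed (use t in auto)
  have tt: "\<exists>\<nu>\<in>?A. t \<otimes> t = t \<otimes> t \<otimes> \<nu>"
    using t by (intro bexI[of _ \<one>]) (auto simp: generate.one)
  have tb: "\<exists>\<nu>\<in>?A. b j \<otimes> t = t \<otimes> b j \<otimes> \<nu>" for j
    by (rule swap[OF bt]) (use t in auto)
  show "\<exists>\<nu>\<in>?A. x \<otimes> y = y \<otimes> x \<otimes> \<nu>" if xy: "x \<in> ?X" "y \<in> ?X" for x y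
  proof -
    from xy consider i j where "x = b i" "y = b j" | j where "x = b j" "y = t"
      | j where "x = t" "y = b j" | "x = t" "y = t" by blast
    thus ?thesis by cases (simp_all only: bb bt tb tt)
  qed
qed

end

section \<open>Words in a family of group elements\<close>

text \<open>The value of a word over an index set under an assignment \<open>g\<close> of group elements to the letters.\<close>

definition list_prod :: "('a, 'b) monoid_scheme \<Rightarrow> ('i \<Rightarrow> 'a) \<Rightarrow> 'i list \<Rightarrow> 'a" where
  "list_prod G g ws = foldr (monoid.mult G) (map g ws) \<one>\<^bsub>G\<^esub>"

lemma list_prod_Nil [simp]: "list_prod G g [] = \<one>\<^bsub>G\<^esub>"
  and list_prod_Cons [simp]: "list_prod G g (w # ws) = g w \<otimes>\<^bsub>G\<^esub> list_prod G g ws"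
  by (simp_all add: list_prod_def)

context group
begin

lemma list_prod_closed [simp, intro]:
  "(\<And>i. g i \<in> carrier G) \<Longrightarrow> list_prod G g ws \<in> carrier G"
  by (induction ws) auto

lemma list_prod_append:
  "(\<And>i. g i \<in> carrier G) \<Longrightarrow> list_prod G g (vs @ ws) = list_prod G g vs \<otimes> list_prod G g ws"
  by (induction vs) (simp_all add: m_assoc)

lemma list_prod_in_generate: "list_prod G g ws \<in> generate G (range g)"
  by (induction ws) (auto intro: generate.intros)

lemma generate_list_prod:
  assumes g: "\<And>i. g i \<in> carrier G"
    and inv: "\<And>i. \<exists>ws. list_prod G g (i # ws) = \<one>"
    and x: "x \<in> generate G (range g)"
  shows "\<exists>ws. x = list_prod G g ws"
  using x
proof induction
  case one
  show ?case by (rule exI[of _ "[]"]) simp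
next
  case (incl h)
  then obtain i where "h = g i" by auto
  thus ?case using g by (intro exI[of _ "[i]"]) simp
next
  case (inv h)
  then obtain i where i: "h = g i" by auto
  obtain ws where ws: "list_prod G g (i # ws) = \<one>" using assms(2) by blast
  have c: "list_prod G g ws \<in> carrier G" using g by auto
  have "g i \<otimes> list_prod G g ws = \<one>" using ws by simp
  hence "list_prod G g ws \<otimes> g i = \<one>" by (rule inv_comm) (use g c in auto)
  hence "inv h = list_prod G g ws" unfolding i by (rule inv_equality) (use g c in auto)
  thus ?case by blast
next
  case (eng h1 h2)
  then obtain vs ws where "h1 = list_prod G g vs" "h2 = list_prod G g ws" by blast
  hence "h1 \<otimes> h2 = list_prod G g (vs @ ws)" using list_prod_append[of g vs ws] g by simp
  thus ?case by blast
qed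

end

text \<open>
  If every relation between the \<open>g i\<close> also holds between the \<open>q i\<close>, then \<open>g i \<mapsto> q i\<close> extends to a
  homomorphism.  Words contain no inverses, so the inverse of each \<open>g i\<close> is required to be the value of
  a word.
\<close>

lemma hom_image_of_words:
  fixes g :: "'i \<Rightarrow> 'a" and q :: "'i \<Rightarrow> 'b"
  assumes W: "group W" and Q: "group Q"
    and g: "\<And>i. g i \<in> carrier W" and q: "\<And>i. q i \<in> carrier Q"
    and inv: "\<And>i. \<exists>ws. list_prod W g (i # ws) = \<one>\<^bsub>W\<^esub>"
    and rel: "\<And>ws. list_prod W g ws = \<one>\<^bsub>W\<^esub> \<Longrightarrow> list_prod Q q ws = \<one>\<^bsub>Q\<^esub>"
    and gen: "carrier Q = generate Q (range q)"
  shows "homomorphic_image_of_subgroup Q W"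
proof -
  interpret W: group W by fact
  interpret Q: group Q by fact
  define V where "V = generate W (range g)"
  have V: "subgroup V W" unfolding V_def by (rule W.generate_is_subgroup) (use g in auto)
  have word: "\<exists>ws. x = list_prod W g ws" if "x \<in> V" for x
    using W.generate_list_prod[OF g inv] that by (auto simp: V_def)
  have eq: "list_prod Q q vs = list_prod Q q ws" if vw: "list_prod W g vs = list_prod W g ws" for vs ws
  proof -
    have "inv\<^bsub>W\<^esub> list_prod W g ws \<in> V"
      unfolding V_def by (rule W.generate_m_inv_closed) (use g in \<open>auto intro: W.list_prod_in_generate\<close>)
    then obtain zs where zs: "inv\<^bsub>W\<^esub> list_prod W g ws = list_prod W g zs" using word by blast
    have 1: "list_prod W g (us @ zs) = \<one>\<^bsub>W\<^esub>" if "list_prod W g us = list_prod W g ws" for us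
      using g that by (simp add: W.list_prod_append zs[symmetric])
    have "list_prod Q q vs \<otimes>\<^bsub>Q\<^esub> list_prod Q q zs = list_prod Q q ws \<otimes>\<^bsub>Q\<^esub> list_prod Q q zs"
      using rel[OF 1, of vs] rel[OF 1, of ws] vw q by (simp add: Q.list_prod_append)
    thus ?thesis using q by simp
  qed
  define \<phi> where "\<phi> x = list_prod Q q (SOME ws. x = list_prod W g ws)" for x
  have \<phi>: "\<phi> (list_prod W g ws) = list_prod Q q ws" for ws
    unfolding \<phi>_def by (rule eq, rule someI2[where a = ws]) auto
  have VQ: "\<phi> \<in> hom (W\<lparr>carrier := V\<rparr>) Q"
  proof (rule homI)
    fix x assume "x \<in> carrier (W\<lparr>carrier := V\<rparr>)"
    thus "\<phi> x \<in> carrier Q" using q by (auto simp: \<phi>_def)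
  next
    fix x y assume "x \<in> carrier (W\<lparr>carrier := V\<rparr>)" "y \<in> carrier (W\<lparr>carrier := V\<rparr>)"
    hence "x \<in> V" "y \<in> V" by simp_all
    then obtain vs ws where "x = list_prod W g vs" "y = list_prod W g ws" using word by blast
    thus "\<phi> (x \<otimes>\<^bsub>W\<lparr>carrier := V\<rparr>\<^esub> y) = \<phi> x \<otimes>\<^bsub>Q\<^esub> \<phi> y"
      using g q \<phi>[of "vs @ ws"] by (simp add: \<phi> W.list_prod_append Q.list_prod_append)
  qed
  interpret \<phi>: group_hom "W\<lparr>carrier := V\<rparr>" Q \<phi>
    using VQ W.subgroup_imp_group[OF V] Q by (simp add: group_hom_def group_hom_axioms_def)
  have "\<phi> (g i) = q i" for i using \<phi>[of "[i]"] g q by simp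
  hence rng: "\<phi> ` range g = range q" by (auto simp: image_def)
  have gV: "range g \<subseteq> V" by (auto simp: V_def generate.incl)
  have "\<phi> ` V = \<phi> ` generate (W\<lparr>carrier := V\<rparr>) (range g)"
    using W.generate_consistent[OF gV V] by (simp add: V_def)
  also have "\<dots> = carrier Q"
    using \<phi>.generate_img[of "range g"] gV by (simp add: rng gen)
  finally have "\<phi> \<in> epi (W\<lparr>carrier := V\<rparr>) Q" using VQ by (simp add: epi_def)
  thus ?thesis unfolding homomorphic_image_of_subgroup_def using V by blast
qed

section \<open>Families whose relations come from a shift\<close>

text \<open>The letter in position \<open>r\<close> (counted from \<open>0\<close>) is shifted by \<open>(k + r) * s\<close>.\<close>

primrec shifted :: "int \<Rightarrow> int \<Rightarrow> int list \<Rightarrow> int list" where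
  "shifted s k [] = []"
| "shifted s k (x # xs) = (x + k * s) # shifted s (k + 1) xs"

lemma shifted_append: "shifted s k (xs @ ys) = shifted s k xs @ shifted s (k + int (length xs)) ys"
  by (induction xs arbitrary: k) (simp_all add: add_ac)

lemma length_shifted [simp]: "length (shifted s k xs) = length xs"
  by (induction xs arbitrary: k) simp_all

lemma shifted_surj: "\<exists>xs. ws = shifted s k xs"
proof (induction ws arbitrary: k)
  case Nil
  show ?case by (rule exI[of _ "[]"]) simp
next
  case (Cons w ws)
  then obtain xs where "ws = shifted s (k + 1) xs" by blast
  thus ?case by (intro exI[of _ "(w - k * s) # xs"]) simp
qed

lemma shifted_replicate:
  "shifted s k (replicate m x) = map (\<lambda>r. x + (k + int r) * s) [0..<m]"
proof (induction m arbitrary: k)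
  case (Suc m)
  show ?case unfolding replicate_Suc shifted.simps Suc map_upt_Suc by (simp add: algebra_simps)
qed simp

text \<open>The case of a twisted family in which all indices are moved.\<close>

locale shift_family = group G for G (structure) +
  fixes b :: "int \<Rightarrow> 'a" and s :: int
  assumes b_closed' [simp, intro]: "b j \<in> carrier G"
    and shift_rel: "b i \<otimes> b (j + s) = b j \<otimes> b (i + s)"
begin

sublocale twisted_family G b UNIV s
  by unfold_locales (simp_all add: shift_rel)

text \<open>The product of the shifted letters \<open>b (x\<^sub>r + (k + r) * s)\<close>.\<close>

definition word :: "int \<Rightarrow> int list \<Rightarrow> 'a" where
  "word k xs = list_prod G b (shifted s k xs)"

lemma word_simps [simp]:
  "word k [] = \<one>" "word k (x # xs) = b (x + k * s) \<otimes> word (k + 1) xs"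
  by (simp_all add: word_def)

lemma word_closed [simp, intro]: "word k xs \<in> carrier G"
  by (simp add: word_def)

lemma word_append: "word k (xs @ ys) = word k xs \<otimes> word (k + int (length xs)) ys"
  by (simp add: word_def shifted_append list_prod_append)

lemma word_swap: "word k (x # y # xs) = word k (y # x # xs)"
proof -
  have "b (x + k * s) \<otimes> b (y + (k + 1) * s) = b (y + k * s) \<otimes> b (x + (k + 1) * s)"
    using shift_rel[of "x + k * s" "y + k * s"] by (simp add: algebra_simps)
  thus ?thesis by (simp add: m_assoc[symmetric])
qed

lemma word_move: "word k (xs @ x # ys) = word k (x # xs @ ys)"
proof (induction xs arbitrary: k)
  case (Cons z xs)
  have "word k ((z # xs) @ x # ys) = word k (z # x # xs @ ys)" using Cons by simp
  thus ?case by (simp only: word_swap append_Cons)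
qed simp

text \<open>The product of a shifted word depends only on the multiset of its letters.\<close>

lemma word_cong_mset: "mset xs = mset ys \<Longrightarrow> word k xs = word k ys"
proof (induction xs arbitrary: ys k)
  case (Cons x xs)
  have "x \<in> set ys" using Cons.prems by (metis list.set_intros(1) set_mset_mset)
  then obtain us vs where ys: "ys = us @ x # vs" by (meson split_list)
  have "word k (x # xs) = word k (x # us @ vs)" using Cons by (simp add: ys)
  thus ?case by (simp only: ys word_move)
qed simp

end

text \<open>
  The relations that hold between the images of the \<open>b j\<close> in \<open>H/O\<close>; by \<open>word_eq_one\<close> below they imply
  all relations of the model in the wreath product.
\<close>

locale periodic_shift_family = shift_family +
  fixes m :: nat and n :: int
  assumes m_pos: "m > 0"
    and dvd: "n dvd int m * s"
    and period: "i mod n = j mod n \<Longrightarrow> b i = b j"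
    and block: "word 0 (replicate m i) = \<one>"
begin

lemma word_cong_index: "(k - l) * s mod n = 0 \<Longrightarrow> word k xs = word l xs"
proof (induction xs arbitrary: k l)
  case (Cons x xs)
  have "b (x + k * s) = b (x + l * s)"
    by (rule period) (use Cons.prems in \<open>simp add: mod_eq_dvd_iff algebra_simps mod_0_imp_dvd\<close>)
  thus ?case using Cons.IH[of "k + 1" "l + 1"] Cons.prems by simp
qed simp

lemma word_mod: "word k (map (\<lambda>x. x mod n) xs) = word k xs"
proof (induction xs arbitrary: k)
  case (Cons x xs)
  have "b (x mod n + k * s) = b (x + k * s)" by (rule period) (simp add: mod_simps)
  thus ?case using Cons by simp
qed simp

text \<open>
  If each letter occurs a multiple of \<open>m\<close> times, then a block of \<open>m\<close> copies of a letter can be moved to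
  the front and cancelled.  The remaining letters are then shifted by \<open>m * s\<close>, which is \<open>0\<close> modulo \<open>n\<close>.
\<close>

lemma word_eq_one_if_dvd_count: "(\<And>x. m dvd count (mset xs) x) \<Longrightarrow> word 0 xs = \<one>"
proof (induction "length xs" arbitrary: xs rule: less_induct)
  case less
  show ?case
  proof (cases xs)
    case (Cons x ys)
    have "m \<le> count (mset xs) x"
      using less.prems[of x] by (rule dvd_imp_le) (simp add: Cons)
    hence "replicate_mset m x \<subseteq># mset xs" by (simp add: count_le_replicate_mset_subset_eq)
    then obtain M where M: "mset xs = replicate_mset m x + M" by (meson subset_mset.le_iff_add)
    obtain zs where zs: "mset zs = M" using ex_mset by blast
    have "size (mset xs) = m + length zs" by (simp add: M zs[symmetric])
    hence "word 0 zs = \<one>"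
    proof (intro less.hyps)
      fix y
      have "count (mset xs) y = (if y = x then m else 0) + count (mset zs) y" by (simp add: M zs)
      thus "m dvd count (mset zs) y" using less.prems[of y] by (auto split: if_splits simp: dvd_add_right_iff)
    qed (use m_pos in simp)
    moreover have "word 0 xs = word 0 (replicate m x @ zs)"
      by (rule word_cong_mset) (simp add: M zs)
    moreover have "word (int m) zs = word 0 zs" by (rule word_cong_index) (use dvd in simp)
    ultimately show ?thesis by (simp add: word_append block)
  qed simp
qed

lemma word_eq_one:
  assumes "n > 0" "\<And>r. r \<in> {0..<n} \<Longrightarrow> m dvd length (filter (\<lambda>x. x mod n = r) xs)"
  shows "word 0 xs = \<one>"
proof -
  have "m dvd count (mset (map (\<lambda>x. x mod n) xs)) r" for r
  proof (cases "r \<in> {0..<n}")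
    case True
    have "count (mset (map (\<lambda>x. x mod n) xs)) r = length (filter (\<lambda>x. x mod n = r) xs)"
      by (induction xs) auto
    thus ?thesis using assms(2)[OF True] by simp
  next
    case False
    hence "r \<notin> set (map (\<lambda>x. x mod n) xs)" using assms(1) by auto
    hence "count (mset (map (\<lambda>x. x mod n) xs)) r = 0" unfolding count_mset_0_iff .
    thus ?thesis by simp
  qed
  from word_eq_one_if_dvd_count[OF this] show ?thesis by (simp add: word_mod)
qed

end

section \<open>The model in the wreath product\<close>

text \<open>
  The element \<open>(\<delta>\<^sub>i, s)\<close>.  The value \<open>1\<close> is reduced modulo \<open>m\<close> because for \<open>m = 1\<close> the cyclic group
  of order \<open>m\<close> has only the element \<open>0\<close>.
\<close>

definition wreath_gen :: "nat \<Rightarrow> nat \<Rightarrow> int \<Rightarrow> int \<Rightarrow> (int \<Rightarrow> int) \<times> int" where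
  "wreath_gen m n s i =
     ((\<lambda>r\<in>{0..<int n}. if r = i mod int n then 1 mod int m else 0), s mod int n)"

context
  fixes m n :: nat and s :: int
  assumes m: "m > 0" and n: "n > 0"
begin

abbreviation (input) "W \<equiv> wreath (integer_mod_group m) (integer_mod_group n)"

lemma carrier_W: "carrier W = ({0..<int n} \<rightarrow>\<^sub>E {0..<int m}) \<times> {0..<int n}"
  using m n by (simp add: wreath_def carrier_integer_mod_group)

lemma mult_W:
  "(f, a) \<otimes>\<^bsub>W\<^esub> (g, c) =
     ((\<lambda>r\<in>{0..<int n}. (f r + g ((r + a) mod int n)) mod int m), (a + c) mod int n)"
  and one_W: "\<one>\<^bsub>W\<^esub> = ((\<lambda>r\<in>{0..<int n}. 0), 0)"
  using m n by (simp_all add: wreath_def carrier_integer_mod_group)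

lemma wreath_gen_closed: "wreath_gen m n s i \<in> carrier W"
  using m n by (simp add: carrier_W wreath_gen_def)

text \<open>The base component counts, modulo \<open>m\<close>, the letters in each residue class.\<close>

lemma wreath_list_prod:
  "list_prod W (wreath_gen m n s) (shifted s k xs) =
     ((\<lambda>r\<in>{0..<int n}. int (length (filter (\<lambda>x. (x + k * s) mod int n = r) xs)) mod int m),
      (int (length xs) * s) mod int n)"
proof (induction xs arbitrary: k)
  case Nil
  show ?case by (simp add: one_W restrict_def)
next
  case (Cons x xs)
  have eq: "(x' + (k + 1) * s) mod int n = (r + s mod int n) mod int n \<longleftrightarrow> (x' + k * s) mod int n = r"
    if "r \<in> {0..<int n}" for r x'
  proof -
    have "(x' + (k + 1) * s) mod int n = (r + s mod int n) mod int n \<longleftrightarrow>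
        int n dvd (x' + (k + 1) * s - (r + s))"
      by (simp add: mod_simps mod_eq_dvd_iff)
    also have "\<dots> \<longleftrightarrow> int n dvd (x' + k * s - r)" by (simp add: algebra_simps)
    also have "\<dots> \<longleftrightarrow> (x' + k * s) mod int n = r mod int n" by (simp add: mod_eq_dvd_iff)
    finally show ?thesis using that by simp
  qed
  have comp: "((if r = (x + k * s) mod int n then 1 mod int m else 0) +
        (\<lambda>r\<in>{0..<int n}. int (length (filter (\<lambda>x. (x + (k + 1) * s) mod int n = r) xs)) mod int m)
          ((r + s mod int n) mod int n)) mod int m
      = int (length (filter (\<lambda>x. (x + k * s) mod int n = r) (x # xs))) mod int m"
    if r: "r \<in> {0..<int n}" for r
  proof -
    have "(r + s mod int n) mod int n \<in> {0..<int n}" using n by simp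
    thus ?thesis by (simp only: restrict_apply' eq[OF r]) (simp add: mod_simps)
  qed
  have "(s mod int n + (int (length xs) * s) mod int n) mod int n =
      (int (length (x # xs)) * s) mod int n"
    by (simp add: mod_simps algebra_simps)
  thus ?case
    unfolding shifted.simps list_prod_Cons Cons.IH
    unfolding wreath_gen_def mult_W prod.inject
    by (intro conjI restrict_ext) (simp_all only: restrict_apply' comp)
qed

lemma homomorphic_image_of_wreath_subgroup:
  assumes Q: "periodic_shift_family Q q s m (int n)" and gen: "carrier Q = generate Q (range q)"
    and dvd: "int n dvd int m * s"
  shows "homomorphic_image_of_subgroup Q W"
proof -
  interpret Q: periodic_shift_family Q q s m "int n" by (rule Q)
  show ?thesis
  proof (rule hom_image_of_words[where g = "wreath_gen m n s" and q = q])
    show "group W" by (intro group_wreath group_integer_mod_group)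
    show "\<exists>ws. list_prod W (wreath_gen m n s) (i # ws) = \<one>\<^bsub>W\<^esub>" for i
    proof
      have "int (length (filter P (replicate m i))) mod int m = 0" for P
        by (cases "P i") simp_all
      hence "list_prod W (wreath_gen m n s) (shifted s 0 (replicate m i)) = \<one>\<^bsub>W\<^esub>"
        unfolding wreath_list_prod one_W using dvd by (simp only: length_replicate dvd_imp_mod_0)
      moreover have "shifted s 0 (replicate m i) = i # shifted s 1 (replicate (m - 1) i)"
        using m by (cases m) simp_all
      ultimately show "list_prod W (wreath_gen m n s) (i # shifted s 1 (replicate (m - 1) i)) = \<one>\<^bsub>W\<^esub>"
        by simp
    qed
    fix ws assume ws: "list_prod W (wreath_gen m n s) ws = \<one>\<^bsub>W\<^esub>"
    obtain xs where xs: "ws = shifted s 0 xs" using shifted_surj by blast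
    have count: "m dvd length (filter (\<lambda>x. x mod int n = r) xs)" if r: "r \<in> {0..<int n}" for r
    proof -
      have "fst (list_prod W (wreath_gen m n s) ws) r = fst \<one>\<^bsub>W\<^esub> r" by (simp only: ws)
      hence "int (length (filter (\<lambda>x. x mod int n = r) xs)) mod int m = 0"
        unfolding xs wreath_list_prod one_W using r by simp
      thus ?thesis by (simp add: mod_eq_0_iff_dvd)
    qed
    have "Q.word 0 xs = \<one>\<^bsub>Q\<^esub>" by (rule Q.word_eq_one[OF _ count]) (use n in auto)
    thus "list_prod Q q ws = \<one>\<^bsub>Q\<^esub>" by (simp add: Q.word_def xs)
  next
    show "q i \<in> carrier Q" for i by (rule Q.b_closed)
  qed (rule Q.group_axioms wreath_gen_closed gen)+
qed

end

section \<open>Shift families normalized by an element\<close>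

lemma (in group) int_pow_shift:
  fixes b :: "int \<Rightarrow> 'a" and n :: int
  assumes b: "\<And>j. b j \<in> carrier G" and t: "t \<in> carrier G"
    and t_b: "\<And>j. t \<otimes> b j = b (j + n) \<otimes> t"
  shows "t [^] (k :: int) \<otimes> b j = b (j + k * n) \<otimes> t [^] k"
proof (induction k arbitrary: j rule: int_induct[where k = 0])
  case base
  show ?case using b by simp
next
  case (step1 k)
  have "t [^] (k + 1) = t \<otimes> t [^] k" using int_pow_mult[OF t, of 1 k] t by (simp add: add.commute)
  hence "t [^] (k + 1) \<otimes> b j = t \<otimes> (t [^] k \<otimes> b j)" "t [^] (k + 1) = t \<otimes> t [^] k"
    using b t by (simp_all add: m_assoc)
  moreover have "t \<otimes> (t [^] k \<otimes> b j) = (t \<otimes> b (j + k * n)) \<otimes> t [^] k"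
    using b t by (simp add: step1.IH m_assoc)
  ultimately show ?case using b t by (simp add: t_b m_assoc algebra_simps)
next
  case (step2 k)
  have "inv t \<otimes> (t \<otimes> b (i - n)) \<otimes> inv t = inv t \<otimes> (b i \<otimes> t) \<otimes> inv t" for i
    using t_b[of "i - n"] by simp
  hence *: "inv t \<otimes> b i = b (i - n) \<otimes> inv t" for i
    using b t by (simp add: m_assoc inv_mult_cancel)
  have "t [^] (k - 1) = inv t \<otimes> t [^] k"
    using int_pow_mult[OF t, of "-1" k] t by (simp add: int_pow_neg)
  hence "t [^] (k - 1) \<otimes> b j = inv t \<otimes> (t [^] k \<otimes> b j)" "t [^] (k - 1) = inv t \<otimes> t [^] k"
    using b t by (simp_all add: m_assoc)
  moreover have "inv t \<otimes> (t [^] k \<otimes> b j) = (inv t \<otimes> b (j + k * n)) \<otimes> t [^] k"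
    using b t by (simp add: step2.IH m_assoc)
  ultimately show ?case using b t by (simp add: * m_assoc algebra_simps)
qed

text \<open>
  For activity \<open>\<sigma>\<^sub>\<tau>\<^sup>s\<close> the element \<open>t\<close> is the adding machine, \<open>m\<close> is the order of \<open>s\<close> modulo \<open>n\<close>, and
  \<open>T\<close> is the integer \<open>m * s / n\<close>.
\<close>

locale normalized_shift_family = shift_family +
  fixes t :: 'a and n :: int and m :: nat and T :: int
  assumes t_closed [simp, intro]: "t \<in> carrier G"
    and t_b: "t \<otimes> b j = b (j + n) \<otimes> t"
    and n_pos: "n > 0" and m_pos: "m > 0"
    and m_s: "int m * s = T * n"
begin

lemma pow_b: "t [^] (k :: int) \<otimes> b j = b (j + k * n) \<otimes> t [^] k"
  by (rule int_pow_shift) (auto simp: t_b)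

lemma pow_d: "t [^] (k :: int) \<otimes> d i j = d (i + k * n) (j + k * n) \<otimes> t [^] k"
proof -
  have "t [^] k \<otimes> d i j = inv (b (j + k * n)) \<otimes> (b (j + k * n) \<otimes> t [^] k) \<otimes> d i j"
    by (simp add: inv_mult_cancel)
  also have "\<dots> = inv (b (j + k * n)) \<otimes> (t [^] k \<otimes> b i)"
    unfolding pow_b[symmetric] by (simp add: d_def m_assoc mult_inv_cancel)
  also have "\<dots> = d (i + k * n) (j + k * n) \<otimes> t [^] k" by (simp add: pow_b d_def m_assoc)
  finally show ?thesis .
qed

lemma pow_word: "t [^] (a :: int) \<otimes> word k xs = word k (map (\<lambda>x. x + a * n) xs) \<otimes> t [^] a"
proof (induction xs arbitrary: k)
  case (Cons x xs)
  have "t [^] a \<otimes> word k (x # xs) = (t [^] a \<otimes> b (x + k * s)) \<otimes> word (k + 1) xs"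
    by (simp add: m_assoc)
  also have "\<dots> = b (x + k * s + a * n) \<otimes> (t [^] a \<otimes> word (k + 1) xs)" by (simp add: pow_b m_assoc)
  finally show ?case by (simp add: Cons m_assoc algebra_simps)
qed simp

lemma word_add: "word (k + l) xs = word k (map (\<lambda>x. x + l * s) xs)"
proof (induction xs arbitrary: k)
  case (Cons x xs)
  have "k + l + 1 = (k + 1) + l" by simp
  thus ?case using Cons[of "k + 1"] by (simp add: algebra_simps)
qed simp

text \<open>For \<open>0 \<le> j < n\<close> this is the element \<open>\<pi>\<^sub>j\<close> (see \<open>list_prod_c_eq_p\<close>).\<close>

definition p :: "int \<Rightarrow> 'a" where
  "p j = word 0 (replicate m j) \<otimes> t [^] T"

lemma p_closed [simp, intro]: "p j \<in> carrier G"
  by (simp add: p_def)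

lemma word_m: "word (int m) xs = word 0 (map (\<lambda>x. x + T * n) xs)"
  using word_add[of 0 "int m" xs] by (simp add: m_s)

text \<open>
  Both sides are values of words with the letter \<open>i\<close> once and the letter \<open>k\<close> repeated \<open>m\<close> times, up
  to a power of \<open>t\<close>.
\<close>

lemma b_p: "b i \<otimes> p (k + s) = p k \<otimes> b i"
proof -
  have "b i \<otimes> word 0 (replicate m (k + s)) = word 0 (i # replicate m k)"
    using word_add[of 0 1 "replicate m k"] by simp
  also have "\<dots> = word 0 (replicate m k @ [i])" by (rule word_cong_mset) simp
  also have "\<dots> = word 0 (replicate m k) \<otimes> b (i + T * n)" by (simp add: word_append m_s)
  finally have "b i \<otimes> p (k + s) = word 0 (replicate m k) \<otimes> (b (i + T * n) \<otimes> t [^] T)"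
    by (simp add: p_def m_assoc[symmetric])
  thus ?thesis by (simp add: pow_b[symmetric] p_def m_assoc)
qed

lemma p_commute: "p i \<otimes> p j = p j \<otimes> p i"
proof -
  have *: "p i \<otimes> p j = word 0 (replicate m i @ replicate m j) \<otimes> (t [^] T \<otimes> t [^] T)" for i j
  proof -
    have "p i \<otimes> p j = word 0 (replicate m i) \<otimes> (t [^] T \<otimes> word 0 (replicate m j)) \<otimes> t [^] T"
      by (simp add: p_def m_assoc)
    thus ?thesis by (simp add: pow_word word_append word_m m_assoc)
  qed
  have "word 0 (replicate m i @ replicate m j) = word 0 (replicate m j @ replicate m i)"
    by (rule word_cong_mset) simp
  thus ?thesis by (simp add: *)
qed

lemma d_p_commute: "d i j \<otimes> p k = p k \<otimes> d i j"
proof -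
  have "inv (b j) \<otimes> p (k - s) = inv (b j) \<otimes> (p (k - s) \<otimes> b j) \<otimes> inv (b j)" by (simp add: m_assoc)
  also have "p (k - s) \<otimes> b j = b j \<otimes> p k" using b_p[of j "k - s"] by simp
  also have "inv (b j) \<otimes> (b j \<otimes> p k) \<otimes> inv (b j) = p k \<otimes> inv (b j)" by (simp add: inv_mult_cancel)
  finally have *: "inv (b j) \<otimes> p (k - s) = p k \<otimes> inv (b j)" .
  have "d i j \<otimes> p k = inv (b j) \<otimes> (p (k - s) \<otimes> b i)"
    using b_p[of i "k - s"] by (simp add: d_def m_assoc)
  also have "\<dots> = p k \<otimes> d i j" by (simp add: m_assoc[symmetric] *) (simp add: d_def m_assoc)
  finally show ?thesis .
qed

lemma pow_p: "t [^] (a :: int) \<otimes> p j = p (j + a * n) \<otimes> t [^] a"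
proof -
  have "t [^] a \<otimes> p j = (t [^] a \<otimes> word 0 (replicate m j)) \<otimes> t [^] T" by (simp add: p_def m_assoc)
  also have "\<dots> = word 0 (replicate m (j + a * n)) \<otimes> (t [^] a \<otimes> t [^] T)"
    by (simp add: pow_word m_assoc)
  also have "t [^] a \<otimes> t [^] T = t [^] T \<otimes> t [^] a" by (simp add: int_pow_mult[symmetric] add.commute)
  finally show ?thesis by (simp add: p_def m_assoc)
qed

text \<open>
  \<open>M_gens\<close> consists of the quotients \<open>b\<^sub>j\<^sup>-\<^sup>1 b\<^bsub>j + an\<^esub>\<close>, which up to reindexing are the commutators of the
  states with powers of \<open>t\<close>.  In contrast to the given generators of \<open>K\<close>, the indices run over all
  integers, so that conjugation by \<open>b k\<close> and \<open>t\<close> merely permutes the generators.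
\<close>

definition M_gens :: "'a set" where "M_gens = {d (j + a * n) j | j a. True}"
definition K_gens :: "'a set" where "K_gens = M_gens \<union> range p"
definition K_sub :: "'a set" where "K_sub = generate G K_gens"
definition O_sub where "O_sub = generate G (K_gens \<union> {t})"
definition H_sub :: "'a set" where "H_sub = generate G (range b \<union> {t})"

lemma gens_closed: "M_gens \<subseteq> carrier G" "K_gens \<subseteq> carrier G" "K_gens \<union> {t} \<subseteq> carrier G"
  "range b \<union> {t} \<subseteq> carrier G"
  by (auto simp: M_gens_def K_gens_def)

lemma subgroups: "subgroup K_sub G" "subgroup O_sub G" "subgroup H_sub G"
  unfolding K_sub_def O_sub_def H_sub_def by (intro generate_is_subgroup gens_closed)+

lemma M_gens_conj_b:
  assumes "x \<in> M_gens"
  shows "b k \<otimes> x \<otimes> inv (b k) \<in> M_gens" "inv (b k) \<otimes> x \<otimes> b k \<in> M_gens"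
proof -
  obtain j a where x: "x = d (j + a * n) j" using assms by (auto simp: M_gens_def)
  have d: "d (j + a * n) j \<in> M_gens" for j a by (auto simp: M_gens_def)
  have "d (j - s + a * n) (j - s) \<otimes> b k = b k \<otimes> x"
    using d_mult_b[of "j - s + a * n" "j - s" k] x by (simp add: algebra_simps)
  from conj_eqI(2)[OF this] d[of "j - s" a] show "b k \<otimes> x \<otimes> inv (b k) \<in> M_gens" by (simp add: x)
  have "x \<otimes> b k = b k \<otimes> d (j + s + a * n) (j + s)"
    using d_mult_b[of "j + a * n" "j" k] x by (simp add: algebra_simps)
  from conj_eqI(1)[OF this] d[of "j + s" a] show "inv (b k) \<otimes> x \<otimes> b k \<in> M_gens" by (simp add: x)
qed

lemma p_conj_b: "b k \<otimes> p j \<otimes> inv (b k) = p (j - s)" "inv (b k) \<otimes> p j \<otimes> b k = p (j + s)"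
  using conj_eqI(2)[of "p (j - s)" "b k" "p j"] conj_eqI(1)[of "p j" "b k" "p (j + s)"]
    b_p[of k "j - s"] b_p[of k j] by simp_all

lemma K_gens_conj_b:
  assumes "x \<in> K_gens"
  shows "b k \<otimes> x \<otimes> inv (b k) \<in> K_gens" "inv (b k) \<otimes> x \<otimes> b k \<in> K_gens"
  using assms M_gens_conj_b[of x k] p_conj_b[of k] by (auto simp: K_gens_def)

lemma K_gens_conj_pow:
  assumes "x \<in> K_gens"
  shows "t [^] (k :: int) \<otimes> x \<otimes> inv (t [^] k) \<in> K_gens"
proof -
  from assms consider j a where "x = d (j + a * n) j" | j where "x = p j"
    by (auto simp: K_gens_def M_gens_def)
  thus ?thesis
  proof cases
    case 1
    have "d (j + k * n + a * n) (j + k * n) \<otimes> t [^] k = t [^] k \<otimes> x"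
      using pow_d[of k "j + a * n" j] 1 by (simp add: algebra_simps)
    from conj_eqI(2)[OF this] show ?thesis by (auto simp: 1 K_gens_def M_gens_def)
  next
    case 2
    have "p (j + k * n) \<otimes> t [^] k = t [^] k \<otimes> x" using pow_p 2 by simp
    from conj_eqI(2)[OF this] show ?thesis by (simp add: 2 K_gens_def)
  qed
qed

lemma K_gens_conj_t:
  assumes "x \<in> K_gens"
  shows "t \<otimes> x \<otimes> inv t \<in> K_gens" "inv t \<otimes> x \<otimes> t \<in> K_gens"
  using K_gens_conj_pow[OF assms, of 1] K_gens_conj_pow[OF assms, of "-1"]
  by (simp_all add: int_pow_neg[of t 1, simplified])

lemma K_commute: "x \<in> K_sub \<Longrightarrow> y \<in> K_sub \<Longrightarrow> x \<otimes> y = y \<otimes> x"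
  unfolding K_sub_def
proof (rule generate_commuting[OF gens_closed(2)])
  fix x y assume "x \<in> K_gens" "y \<in> K_gens"
  thus "x \<otimes> y = y \<otimes> x"
    unfolding K_gens_def M_gens_def using d_commute p_commute d_p_commute by auto
qed

lemma comm_group_K: "comm_group (G\<lparr>carrier := K_sub\<rparr>)"
  by (rule comm_group_subgroupI[OF subgroups(1) K_commute])

lemma in_H: "b j \<in> H_sub" "t \<in> H_sub" "d i j \<in> H_sub" "t [^] (k :: int) \<in> H_sub" "p j \<in> H_sub"
proof -
  interpret H_sub: subgroup H_sub G by (rule subgroups)
  show b: "b j \<in> H_sub" for j by (auto simp: H_sub_def intro: generate.incl)
  show t: "t \<in> H_sub" by (auto simp: H_sub_def intro: generate.incl)
  show "d i j \<in> H_sub" by (simp add: d_def b)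
  show tk: "t [^] k \<in> H_sub" for k :: int by (rule subgroup_int_pow_closed[OF subgroups(3) t])
  have "word k xs \<in> H_sub" for k xs by (induction xs arbitrary: k) (simp_all add: b)
  thus "p j \<in> H_sub" by (simp add: p_def tk)
qed

lemma gens_in_H: "K_gens \<subseteq> H_sub" "K_gens \<union> {t} \<subseteq> H_sub"
  using in_H by (auto simp: K_gens_def M_gens_def)

lemma K_normal_H: "K_sub \<lhd> G\<lparr>carrier := H_sub\<rparr>"
  unfolding K_sub_def H_sub_def
proof (rule generate_normal_in_generate[OF gens_closed(4)])
  show "K_gens \<subseteq> generate G (range b \<union> {t})" using gens_in_H by (simp add: H_sub_def)
qed (use K_gens_conj_b K_gens_conj_t in \<open>auto intro!: generate.incl\<close>)

lemma O_normal_H: "O_sub \<lhd> G\<lparr>carrier := H_sub\<rparr>"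
  unfolding O_sub_def H_sub_def
proof (rule generate_normal_in_generate[OF gens_closed(4)])
  let ?O_sub = "generate G (K_gens \<union> {t})"
  show "K_gens \<union> {t} \<subseteq> generate G (range b \<union> {t})" using gens_in_H by (simp add: H_sub_def)
  have t: "t \<in> ?O_sub" by (auto intro: generate.incl)
  have d: "d (j + a * n) j \<in> ?O_sub" for j a by (auto simp: K_gens_def M_gens_def intro: generate.incl)
  have "b k \<otimes> t \<otimes> inv (b k) \<in> ?O_sub" "inv (b k) \<otimes> t \<otimes> b k \<in> ?O_sub" for k
  proof -
    have "inv (b k) \<otimes> t \<otimes> b k = d (k + 1 * n) k \<otimes> t" by (simp add: m_assoc t_b d_def)
    thus "inv (b k) \<otimes> t \<otimes> b k \<in> ?O_sub" using d t by (simp add: generate.eng del: mult_1)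
    have "inv (b (k + n)) \<otimes> (t \<otimes> b k) \<otimes> inv (b k) = inv (b (k + n)) \<otimes> (b (k + n) \<otimes> t) \<otimes> inv (b k)"
      by (simp add: t_b)
    hence "inv (b (k + n)) \<otimes> t = t \<otimes> inv (b k)" by (simp add: m_assoc inv_mult_cancel)
    hence "b k \<otimes> t \<otimes> inv (b k) = b k \<otimes> inv (b (k + n)) \<otimes> t" by (simp add: m_assoc)
    also have "b k \<otimes> inv (b (k + n)) = d ((k + n - s) + (-1) * n) (k + n - s)"
      by (simp add: d_alt)
    finally show "b k \<otimes> t \<otimes> inv (b k) \<in> ?O_sub" using d t by (simp only: generate.eng)
  qed
  moreover have "t \<otimes> t \<otimes> inv t = t" "inv t \<otimes> t \<otimes> t = t" by (simp_all add: m_assoc)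
  moreover have "y \<in> ?O_sub" if "y \<in> K_gens" for y using that by (auto intro: generate.incl)
  ultimately show "x \<otimes> y \<otimes> inv x \<in> ?O_sub" "inv x \<otimes> y \<otimes> x \<in> ?O_sub"
    if "x \<in> range b \<union> {t}" "y \<in> K_gens \<union> {t}" for x y
    using that K_gens_conj_b K_gens_conj_t t by auto
qed

lemma O_eq_set_mult: "O_sub = K_sub <#> generate G {t}"
proof
  let ?H_sub = "G\<lparr>carrier := H_sub\<rparr>"
  have T: "subgroup (generate G {t}) ?H_sub"
    by (intro subgroup_incl subgroups generate_is_subgroup generate_subgroup_incl) (simp_all add: in_H)
  have incl: "subgroup X ?H_sub \<Longrightarrow> subgroup X G" for X
    by (rule incl_subgroup[OF subgroups(3)])
  have least: "K_gens \<union> {t} \<subseteq> X \<Longrightarrow> subgroup X G \<Longrightarrow> O_sub \<subseteq> X" for X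
    unfolding O_sub_def by (rule generate_subgroup_incl)
  have mono: "K_sub \<subseteq> O_sub" "generate G {t} \<subseteq> O_sub"
    unfolding K_sub_def O_sub_def by (rule mono_generate, blast)+
  interpret second_isomorphism_grp K_sub ?H_sub "generate G {t}"
    by (intro second_isomorphism_grp.intro second_isomorphism_grp_axioms.intro K_normal_H T)
  have eq: "K_sub <#>\<^bsub>?H_sub\<^esub> generate G {t} = K_sub <#> generate G {t}" by (simp add: set_mult_def)
  have sub: "subgroup (K_sub <#> generate G {t}) G"
    using incl[OF normal_set_mult_subgroup] by (simp only: eq)
  have "K_gens \<subseteq> K_sub" "t \<in> generate G {t}" by (auto simp: K_sub_def intro: generate.incl)
  thus "O_sub \<subseteq> K_sub <#> generate G {t}"
    using H_contained_in_set_mult S_contained_in_set_mult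
    by (intro least[OF _ sub]) (auto simp: eq)
  from mono show "K_sub <#> generate G {t} \<subseteq> O_sub"
    using subgroup.m_closed[OF subgroups(2)] by (auto simp: set_mult_def)
qed

lemma O_subset_H: "O_sub \<subseteq> H_sub"
  unfolding O_sub_def by (intro generate_subgroup_incl gens_in_H subgroups)

lemma K_normal_O: "K_sub \<lhd> G\<lparr>carrier := O_sub\<rparr>"
proof -
  interpret H_sub: group "G\<lparr>carrier := H_sub\<rparr>" by (rule subgroup_imp_group[OF subgroups(3)])
  have "K_sub \<lhd> (G\<lparr>carrier := H_sub\<rparr>)\<lparr>carrier := O_sub\<rparr>"
    by (intro H_sub.normal_restrict_supergroup K_normal_H subgroup_incl subgroups O_subset_H)
      (auto simp: K_sub_def O_sub_def intro!: mono_generate)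
  thus ?thesis by simp
qed

lemma H_metabelian: "metabelian (G\<lparr>carrier := H_sub\<rparr>)"
  unfolding H_sub_def by (rule metabelian_family[where n = n]) (auto simp: t_b)

text \<open>
  In \<open>H/O\<close> the images of the \<open>b j\<close> depend only on \<open>j\<close> modulo \<open>n\<close> because \<open>t\<close> lies in \<open>O\<close>, and blocks
  of \<open>m\<close> equal letters vanish because \<open>p i\<close> lies in \<open>O\<close>.
\<close>

lemma H_quotient: "homomorphic_image_of_subgroup (G\<lparr>carrier := H_sub\<rparr> Mod O_sub)
    (wreath (integer_mod_group m) (integer_mod_group (nat n)))"
proof -
  interpret HG: group "G\<lparr>carrier := H_sub\<rparr>" by (rule subgroup_imp_group[OF subgroups(3)])
  interpret O_sub: normal O_sub "G\<lparr>carrier := H_sub\<rparr>" by (rule O_normal_H)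
  let ?Q = "G\<lparr>carrier := H_sub\<rparr> Mod O_sub"
  interpret Q: group ?Q by (rule O_sub.factorgroup_is_group)
  define \<pi> where "\<pi> = (\<lambda>a. O_sub #>\<^bsub>G\<lparr>carrier := H_sub\<rparr>\<^esub> a)"
  interpret \<pi>: group_hom "G\<lparr>carrier := H_sub\<rparr>" ?Q \<pi>
    unfolding \<pi>_def by unfold_locales (rule O_sub.r_coset_hom_Mod)
  have \<pi>_mult: "\<pi> (x \<otimes> y) = \<pi> x \<otimes>\<^bsub>?Q\<^esub> \<pi> y" if "x \<in> H_sub" "y \<in> H_sub" for x y
    using \<pi>.hom_mult[of x y] that by simp
  have \<pi>_O: "\<pi> x = \<one>\<^bsub>?Q\<^esub>" if "x \<in> O_sub" for x
    unfolding \<pi>_def one_FactGroup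
    by (rule HG.coset_join2[OF _ O_sub.subgroup_axioms that]) (use that O_subset_H in auto)
  have pow_O: "t [^] (k :: int) \<in> O_sub" for k
    by (rule subgroup_int_pow_closed[OF subgroups(2)]) (auto simp: O_sub_def intro: generate.incl)
  define q where "q j = \<pi> (b j)" for j
  have q_closed: "q j \<in> carrier ?Q" for j using \<pi>.hom_closed[of "b j"] by (simp add: q_def in_H)
  have q_add: "q (j + k * n) = q j" for j k
    using \<pi>_mult[of "t [^] k" "b j"] \<pi>_mult[of "b (j + k * n)" "t [^] k"] q_closed
    by (simp add: in_H pow_b \<pi>_O[OF pow_O] q_def[symmetric] del: mult_FactGroup one_FactGroup)
  interpret Qs: shift_family ?Q q s
    by unfold_locales (use q_closed shift_rel in
      \<open>auto simp: q_def \<pi>_mult[symmetric] in_H simp del: mult_FactGroup\<close>)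
  have wd: "Qs.word k xs = \<pi> (word k xs) \<and> word k xs \<in> H_sub" for k xs
  proof (induction xs arbitrary: k)
    case Nil
    show ?case using \<pi>_O[OF subgroup.one_closed[OF subgroups(2)]] subgroup.one_closed[OF subgroups(3)]
      by simp
  next
    case (Cons x xs)
    thus ?case using subgroup.m_closed[OF subgroups(3)] by (simp add: in_H q_def[of "x + k * s"] \<pi>_mult)
  qed
  have "periodic_shift_family ?Q q s m n"
  proof unfold_locales
    show "n dvd int m * s" by (simp add: m_s)
    have "q i = q (i mod n)" for i using q_add[of "i mod n" "i div n"] by (simp add: add.commute)
    thus "q i = q j" if "i mod n = j mod n" for i j using that by metis
  next
    fix i
    have "word 0 (replicate m i) = p i \<otimes> t [^] (- T)"
      by (simp add: p_def m_assoc int_pow_neg)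
    also have "\<dots> \<in> O_sub"
      by (rule subgroup.m_closed[OF subgroups(2) _ pow_O]) (auto simp: O_sub_def K_gens_def intro: generate.incl)
    finally show "Qs.word 0 (replicate m i) = \<one>\<^bsub>?Q\<^esub>" using wd \<pi>_O by simp
  qed (rule m_pos)
  moreover have "carrier ?Q = generate ?Q (range q)"
  proof
    have H_gen: "generate (G\<lparr>carrier := H_sub\<rparr>) (range b \<union> {t}) = H_sub"
      using generate_consistent[OF _ subgroups(3), of "range b \<union> {t}"] in_H by (auto simp: H_sub_def)
    have "carrier ?Q = \<pi> ` H_sub" by (simp add: carrier_FactGroup \<pi>_def)
    also have "\<dots> = \<pi> ` generate (G\<lparr>carrier := H_sub\<rparr>) (range b \<union> {t})" by (simp only: H_gen)
    also have "\<dots> = generate ?Q (\<pi> ` (range b \<union> {t}))"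
      by (rule \<pi>.generate_img[symmetric]) (use in_H in auto)
    also have "\<dots> \<subseteq> generate ?Q (range q)"
    proof (rule Q.generate_subgroup_incl)
      have "\<pi> t = \<one>\<^bsub>?Q\<^esub>" by (rule \<pi>_O) (auto simp: O_sub_def intro: generate.incl)
      thus "\<pi> ` (range b \<union> {t}) \<subseteq> generate ?Q (range q)"
        by (auto simp del: one_FactGroup simp: q_def intro: generate.incl generate.one)
      show "subgroup (generate ?Q (range q)) ?Q"
        by (rule Q.generate_is_subgroup) (use q_closed in auto)
    qed
    finally show "carrier ?Q \<subseteq> generate ?Q (range q)" .
    show "generate ?Q (range q) \<subseteq> carrier ?Q"
      by (rule Q.generate_incl) (use q_closed in auto)
  qed
  ultimately show ?thesis
    using n_pos m_pos m_s by (intro homomorphic_image_of_wreath_subgroup[where s = s and q = q]) auto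
qed

text \<open>The states recovered from their coordinates; see \<open>coord\<close> below for the inverse formula.\<close>

definition c :: "int \<Rightarrow> 'a" where
  "c j = t [^] (- (j div n)) \<otimes> b j \<otimes> t [^] ((j + s) div n)"

lemma commutator_c:
  assumes "i \<in> {0..<n}"
  shows "commutator G (c i) (t [^] (k :: int))
    = d (i - (i + s) div n * n + (- k) * n) (i - (i + s) div n * n)"
proof -
  define q where "q = (i + s) div n"
  define i' where "i' = i - q * n"
  have "c i = b i \<otimes> t [^] q" using assms by (simp add: c_def q_def)
  also have "\<dots> = t [^] q \<otimes> b i'" by (simp add: pow_b i'_def)
  finally have c: "c i = t [^] q \<otimes> b i'" .
  have "commutator G (c i) (t [^] k)
      = inv (b i') \<otimes> ((inv (t [^] q) \<otimes> inv (t [^] k) \<otimes> t [^] q) \<otimes> b i') \<otimes> t [^] k"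
    by (simp add: commutator_def c inv_mult_group m_assoc)
  also have "inv (t [^] q) \<otimes> inv (t [^] k) \<otimes> t [^] q = t [^] (- k)"
    by (simp add: int_pow_neg[symmetric] int_pow_mult[symmetric])
  also have "inv (b i') \<otimes> (t [^] (- k) \<otimes> b i') \<otimes> t [^] k = d (i' + (- k) * n) i' \<otimes> (t [^] (- k) \<otimes> t [^] k)"
    by (simp add: pow_b d_def m_assoc)
  also have "t [^] (- k) \<otimes> t [^] k = \<one>" by (simp add: int_pow_mult[symmetric])
  finally show ?thesis by (simp add: i'_def q_def)
qed

lemma list_prod_c:
  "list_prod G c (shifted s k (replicate l i))
    = t [^] (- ((i + k * s) div n)) \<otimes> word k (replicate l i) \<otimes> t [^] ((i + (k + int l) * s) div n)"
proof (induction l arbitrary: k)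
  case 0
  show ?case by (simp add: int_pow_mult[symmetric])
next
  case (Suc l)
  define x where "x = (i + (k + 1) * s) div n"
  have x: "(i + k * s + s) div n = x" by (simp add: x_def algebra_simps)
  have "list_prod G c (shifted s k (replicate (Suc l) i))
      = t [^] (- ((i + k * s) div n)) \<otimes> b (i + k * s) \<otimes> (t [^] x \<otimes> t [^] (- x)) \<otimes> word (k + 1) (replicate l i)
        \<otimes> t [^] ((i + (k + 1 + int l) * s) div n)"
    unfolding replicate_Suc shifted.simps list_prod_Cons Suc c_def x x_def[symmetric] by (simp add: m_assoc)
  also have "t [^] x \<otimes> t [^] (- x) = \<one>" by (simp add: int_pow_mult[symmetric])
  finally show ?case by (simp add: m_assoc add_ac)
qed

lemma list_prod_c_eq_p:
  assumes "i \<in> {0..<n}"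
  shows "list_prod G c (shifted s 0 (replicate m i)) = p i"
proof -
  have "(i + int m * s) div n = T" using assms by (simp add: m_s)
  thus ?thesis using assms by (simp add: list_prod_c p_def)
qed

text \<open>
  Translating all letters by the same multiple of \<open>n\<close> changes the value of a word only by a factor from
  the subgroup generated by \<open>M_gens\<close>, because that subgroup is normalized by the family.
\<close>

lemma word_add_period:
  "\<exists>\<mu>\<in>generate G M_gens. word k (map (\<lambda>x. x + a * n) xs) = \<mu> \<otimes> word k xs"
proof (induction xs arbitrary: k)
  case Nil
  show ?case by (intro bexI[of _ \<one>]) (auto intro: generate.one)
next
  case (Cons x xs)
  define y where "y = x + k * s"
  obtain \<mu> where \<mu>: "\<mu> \<in> generate G M_gens" "word (k + 1) (map (\<lambda>x. x + a * n) xs) = \<mu> \<otimes> word (k + 1) xs"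
    using Cons by blast
  have c: "\<mu> \<in> carrier G" using \<mu>(1) generate_in_carrier[OF gens_closed(1)] by blast
  have d: "d (y - s + a * n) (y - s) = b (y + a * n) \<otimes> inv (b y)" by (simp add: d_alt algebra_simps)
  have "word k (map (\<lambda>x. x + a * n) (x # xs)) = b (y + a * n) \<otimes> (\<mu> \<otimes> word (k + 1) xs)"
    using \<mu>(2) by (simp add: y_def add.assoc add.commute[of "k * s"])
  also have "\<dots> = d (y - s + a * n) (y - s) \<otimes> (b y \<otimes> \<mu> \<otimes> inv (b y)) \<otimes> word k (x # xs)"
    using c unfolding d by (simp add: m_assoc inv_mult_cancel y_def[symmetric])
  finally have "word k (map (\<lambda>x. x + a * n) (x # xs)) = \<dots>" .
  moreover have "b y \<otimes> \<mu> \<otimes> inv (b y) \<in> generate G M_gens"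
    by (rule generate_conj_closed[OF gens_closed(1) _ _ \<mu>(1)]) (auto intro: generate.incl M_gens_conj_b)
  moreover have "d (y - s + a * n) (y - s) \<in> generate G M_gens"
    by (rule generate.incl) (auto simp: M_gens_def)
  ultimately show ?case by (blast intro: generate.eng)
qed

text \<open>The indices \<open>0, \<dots>, n - 1\<close> suffice to generate the subgroup.\<close>

lemma K_sub_eq:
  "generate G ({commutator G (c i) (t [^] k) | i (k :: int). i \<in> {0..<n}} \<union> p ` {0..<n}) = K_sub"
    (is "generate G ?S = _")
proof
  have "commutator G (c i) (t [^] k) \<in> M_gens" if "i \<in> {0..<n}" for i and k :: int
    unfolding commutator_c[OF that] M_gens_def by blast
  hence S_K: "?S \<subseteq> K_gens" by (auto simp: K_gens_def)
  thus "generate G ?S \<subseteq> K_sub" unfolding K_sub_def by (rule mono_generate)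
  have Sc: "?S \<subseteq> carrier G" using S_K gens_closed(2) by (rule order_trans)
  have sub: "subgroup (generate G ?S) G" by (rule generate_is_subgroup[OF Sc])
  have d: "d (j + a * n) j \<in> generate G ?S" for j a
  proof -
    define i where "i = j mod n"
    define i' where "i' = i - (i + s) div n * n"
    define k where "k = - (j div n) - (i + s) div n"
    have i: "i \<in> {0..<n}" using n_pos by (simp add: i_def)
    have e: "d (i' + (- l) * n) i' \<in> generate G ?S" for l
      using i commutator_c[OF i, of l, symmetric] unfolding i'_def[symmetric]
      by (intro generate.incl) auto
    have j: "i' + (- k) * n = j"
      using div_mult_mod_eq[of j n] by (simp add: i'_def k_def i_def[symmetric] algebra_simps)
    have ja: "i' + (- (k - a)) * n = j + a * n" unfolding j[symmetric] by (simp add: algebra_simps)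
    have "inv (d j i') \<otimes> d (j + a * n) i' \<in> generate G ?S"
      using e[of k] e[of "k - a"] unfolding j ja
      by (intro generate.eng generate_m_inv_closed[OF Sc])
    also have "inv (d j i') \<otimes> d (j + a * n) i' = d (j + a * n) j"
      by (simp add: d_def inv_mult_group m_assoc mult_inv_cancel)
    finally show ?thesis .
  qed
  hence M: "generate G M_gens \<subseteq> generate G ?S"
    by (intro generate_subgroup_incl sub) (auto simp: M_gens_def)
  have "p j \<in> generate G ?S" for j
  proof -
    obtain \<mu> where \<mu>: "\<mu> \<in> generate G M_gens"
      "word 0 (map (\<lambda>x. x + j div n * n) (replicate m (j mod n))) = \<mu> \<otimes> word 0 (replicate m (j mod n))"
      using word_add_period by blast
    have "\<mu> \<in> carrier G" using \<mu>(1) generate_in_carrier[OF gens_closed(1)] by blast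
    hence "p j = \<mu> \<otimes> p (j mod n)" using \<mu>(2) by (simp add: p_def m_assoc)
    moreover have "p (j mod n) \<in> generate G ?S" using n_pos by (intro generate.incl) auto
    ultimately show ?thesis using \<mu>(1) M by (auto intro: generate.eng)
  qed
  thus "K_sub \<subseteq> generate G ?S"
    unfolding K_sub_def using d by (intro generate_subgroup_incl sub) (auto simp: K_gens_def M_gens_def)
qed

end

lemma (in group) generate_range_eq:
  fixes b c :: "int \<Rightarrow> 'a" and n :: int
  assumes c: "\<And>j. c j \<in> carrier G" and t: "t \<in> carrier G" and n: "n > 0"
    and b: "\<And>j. \<exists>(x :: int) (y :: int). b j = t [^] x \<otimes> c (j mod n) \<otimes> t [^] y"
  shows "generate G (range b \<union> {t}) = generate G (c ` {0..<n} \<union> {t})"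
proof
  let ?C = "generate G (c ` {0..<n} \<union> {t})" and ?B = "generate G (range b \<union> {t})"
  have Cc: "c ` {0..<n} \<union> {t} \<subseteq> carrier G" using c t by auto
  have Bc: "range b \<union> {t} \<subseteq> carrier G"
  proof -
    have "b j \<in> carrier G" for j
    proof -
      obtain x y :: int where "b j = t [^] x \<otimes> c (j mod n) \<otimes> t [^] y" using b[of j] by blast
      thus ?thesis using c t by simp
    qed
    thus ?thesis using t by auto
  qed
  have subs: "subgroup ?C G" "subgroup ?B G" by (intro generate_is_subgroup Cc Bc)+
  have t_in: "t \<in> ?C" "t \<in> ?B" by (auto intro: generate.incl)
  have pow_in: "t [^] (k :: int) \<in> ?C" "t [^] (k :: int) \<in> ?B" for k
    using subgroup_int_pow_closed subs t_in by blast+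
  have "b j \<in> ?C" for j
  proof -
    obtain x y :: int where "b j = t [^] x \<otimes> c (j mod n) \<otimes> t [^] y" using b[of j] by blast
    moreover have "c (j mod n) \<in> ?C" using n by (intro generate.incl) auto
    ultimately show ?thesis using pow_in by (simp add: generate.eng)
  qed
  thus "?B \<subseteq> ?C" using t_in by (intro generate_subgroup_incl subs) auto
  have "c i \<in> ?B" if "i \<in> {0..<n}" for i
  proof -
    obtain x y :: int where "b i = t [^] x \<otimes> c (i mod n) \<otimes> t [^] y" using b[of i] by blast
    hence "b i = t [^] x \<otimes> c i \<otimes> t [^] y" using that by simp
    hence "c i = inv (t [^] x) \<otimes> b i \<otimes> inv (t [^] y)"
      using c t by (simp add: m_assoc inv_mult_cancel)
    also have "\<dots> = t [^] (- x) \<otimes> b i \<otimes> t [^] (- y)" using t by (simp add: int_pow_neg)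
    also have "b i \<in> ?B" by (intro generate.incl) auto
    hence "t [^] (- x) \<otimes> b i \<otimes> t [^] (- y) \<in> ?B" using pow_in by (simp add: generate.eng)
    finally show ?thesis .
  qed
  thus "?C \<subseteq> ?B" using t_in by (intro generate_subgroup_incl subs) auto
qed

section \<open>Automorphisms of the tree\<close>

lemma mult_aut_tree [simp]: "(\<alpha> \<otimes>\<^bsub>aut_tree n\<^esub> \<beta>) u = \<beta> (\<alpha> u)"
  and one_aut_tree [simp]: "\<one>\<^bsub>aut_tree n\<^esub> u = u"
  by (simp_all add: aut_tree_def)

lemma aut_tree_permutes: "\<alpha> \<in> carrier (aut_tree n) \<Longrightarrow> \<alpha> permutes words n"
  and aut_tree_Nil: "\<alpha> \<in> carrier (aut_tree n) \<Longrightarrow> \<alpha> [] = []"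
  by (simp_all add: aut_tree_def)

lemma aut_tree_eqI:
  assumes "\<alpha> \<in> carrier (aut_tree n)" "\<beta> \<in> carrier (aut_tree n)" "\<And>u. u \<in> words n \<Longrightarrow> \<alpha> u = \<beta> u"
  shows "\<alpha> = \<beta>"
  using assms permutes_not_in[OF aut_tree_permutes] by (metis ext)

lemma aut_tree_inj: "\<alpha> \<in> carrier (aut_tree n) \<Longrightarrow> \<alpha> u = \<alpha> v \<Longrightarrow> u = v"
  using permutes_inj[OF aut_tree_permutes] by (meson injD)

lemma aut_tree_in_words [simp]: "\<alpha> \<in> carrier (aut_tree n) \<Longrightarrow> \<alpha> u \<in> words n \<longleftrightarrow> u \<in> words n"
  using permutes_in_image[OF aut_tree_permutes] .

lemma aut_tree_letter:
  assumes "\<alpha> \<in> carrier (aut_tree n)" "i < n"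
  shows "\<alpha> [i] = [activity n \<alpha> i]" and "activity n \<alpha> i < n"
proof -
  obtain z where "z < n" "\<alpha> [i] = [z]"
    using aut_tree_snoc[OF assms(1), of "[]" i] assms by (auto simp: aut_tree_Nil)
  thus "\<alpha> [i] = [activity n \<alpha> i]" "activity n \<alpha> i < n" using assms(2) by (simp_all add: activity_def)
qed

lemma tree_adj_Cons [simp]: "tree_adj (a # u) (a # v) \<longleftrightarrow> tree_adj u v"
  by (simp add: tree_adj_def)

lemma state_closed:
  assumes \<alpha>: "\<alpha> \<in> carrier (aut_tree n)" and n: "n > 0"
  shows "state n \<alpha> j \<in> carrier (aut_tree n)"
proof -
  define i where "i = nat (j mod int n)"
  have i: "i < n" using n by (simp add: i_def nat_less_iff)
  have st: "state n \<alpha> j = state n \<alpha> (int i)" using n by (simp add: state_def i_def fun_eq_iff)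
  note act = aut_tree_Cons[OF \<alpha> i]
  have in_words: "state n \<alpha> j u \<in> words n" if "u \<in> words n" for u
    using act[OF that] aut_tree_in_words[OF \<alpha>, of "i # u"] that i unfolding st by simp
  have "state n \<alpha> j permutes words n"
  proof (rule bij_imp_permutes)
    show "state n \<alpha> j u = u" if "u \<notin> words n" for u using that by (simp add: state_def)
    show "bij_betw (state n \<alpha> j) (words n) (words n)"
    proof (rule bij_betw_imageI)
      show "inj_on (state n \<alpha> j) (words n)"
      proof (rule inj_onI)
        fix u v assume "u \<in> words n" "v \<in> words n" "state n \<alpha> j u = state n \<alpha> j v"
        hence "\<alpha> (i # u) = \<alpha> (i # v)" by (simp add: act st)
        thus "u = v" using aut_tree_inj[OF \<alpha>] by blast
      qed
      have "v \<in> state n \<alpha> j ` words n" if v: "v \<in> words n" for v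
      proof -
        have iv: "activity n \<alpha> i # v \<in> words n" using v aut_tree_letter[OF \<alpha> i] by simp
        obtain w where w: "\<alpha> w = activity n \<alpha> i # v"
          using permutes_surj[OF aut_tree_permutes[OF \<alpha>]] by (metis surjD)
        have "w \<in> words n" using aut_tree_in_words[OF \<alpha>, of w] w iv by simp
        moreover have "w \<noteq> []" using w aut_tree_Nil[OF \<alpha>] by auto
        ultimately obtain k u where ku: "w = k # u" "k < n" "u \<in> words n" by (cases w) auto
        have eq: "activity n \<alpha> k = activity n \<alpha> i" "state n \<alpha> (int k) u = v"
          using w aut_tree_Cons[OF \<alpha> ku(2,3)] by (simp_all add: ku(1))
        have "\<alpha> [k] = \<alpha> [i]" using aut_tree_letter[OF \<alpha>] ku(2) i eq(1) by simp
        hence "k = i" using aut_tree_inj[OF \<alpha>] by blast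
        thus ?thesis using eq(2) ku(3) st by (auto intro: image_eqI[of _ _ u])
      qed
      thus "state n \<alpha> j ` words n = words n" using in_words by auto
    qed
  qed
  moreover have "state n \<alpha> j [] = []"
    using act[of "[]"] aut_tree_letter(1)[OF \<alpha> i] by (simp add: st)
  moreover have "tree_adj (state n \<alpha> j u) (state n \<alpha> j v) \<longleftrightarrow> tree_adj u v"
    if "u \<in> words n" "v \<in> words n" for u v
  proof -
    have "tree_adj (\<alpha> (i # u)) (\<alpha> (i # v)) \<longleftrightarrow> tree_adj (i # u) (i # v)"
      using \<alpha> that i by (simp add: aut_tree_def)
    thus ?thesis using act that by (simp add: st)
  qed
  ultimately show ?thesis by (simp add: aut_tree_def)
qed

section \<open>Integer coordinates\<close>

text \<open>
  The vertex \<open>[j, u]\<close>.  The pairs \<open>(j, u)\<close> and \<open>(j + n, v)\<close> give the same vertex if \<open>\<tau>\<close> maps \<open>v\<close> to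
  \<open>u\<close>.
\<close>

definition lift :: "nat \<Rightarrow> int \<Rightarrow> nat list \<Rightarrow> nat list" where
  "lift n j u = nat (j mod int n) # (adding_machine n [^]\<^bsub>aut_tree n\<^esub> (j div int n)) u"

lemma mod_div_add_one:
  fixes j :: int
  assumes "n > 0"
  shows "(j + 1) mod n = (if j mod n = n - 1 then 0 else j mod n + 1)"
    and "(j + 1) div n = (if j mod n = n - 1 then j div n + 1 else j div n)"
proof -
  have *: "j + 1 = (j mod n + 1) + j div n * n" by simp
  have r: "0 \<le> j mod n" "j mod n < n" using assms by simp_all
  have "(j + 1) mod n = (j mod n + 1) mod n" by (simp add: mod_simps)
  thus "(j + 1) mod n = (if j mod n = n - 1 then 0 else j mod n + 1)" using r by auto
  have "(j + 1) div n = j div n + (j mod n + 1) div n"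
    unfolding * using assms by (subst div_mult_self1) simp_all
  thus "(j + 1) div n = (if j mod n = n - 1 then j div n + 1 else j div n)"
    using r assms by (cases "j mod n = n - 1") (simp, simp add: div_pos_pos_trivial)
qed

context
  fixes n :: nat
  assumes n: "n > 0" and \<tau>: "adding_machine n \<in> carrier (aut_tree n)"
begin

abbreviation (input) "Aut \<equiv> aut_tree n"
abbreviation (input) "\<tau> \<equiv> adding_machine n"

interpretation group Aut by (rule group_aut_tree)

lemma lift_inj: "lift n j u = lift n j v \<Longrightarrow> u = v"
  using aut_tree_inj[OF int_pow_closed[OF \<tau>]] by (auto simp: lift_def)

lemma adding_machine_lift: "u \<in> words n \<Longrightarrow> \<tau> (lift n j u) = lift n (j + 1) u"
proof -
  assume u: "u \<in> words n"
  define v where "v = (\<tau> [^]\<^bsub>Aut\<^esub> (j div int n)) u"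
  have v: "v \<in> words n" using u \<tau> by (simp add: v_def)
  have n': "int n > 0" using n by simp
  have r: "0 \<le> j mod int n" "j mod int n < int n" using n by simp_all
  have \<tau>v: "\<tau> v = (\<tau> [^]\<^bsub>Aut\<^esub> (j div int n + 1)) u" using \<tau> by (simp add: int_pow_mult v_def)
  have "\<tau> (nat (j mod int n) # v)
      = (if nat (j mod int n) + 1 = n then 0 # \<tau> v else (nat (j mod int n) + 1) # v)"
    using v r by (simp add: adding_machine_def nat_less_iff)
  also have "nat (j mod int n) + 1 = n \<longleftrightarrow> j mod int n = int n - 1" using r by linarith
  finally show ?thesis
    using mod_div_add_one[OF n', of j] r by (simp add: lift_def v_def[symmetric] \<tau>v nat_add_distrib)
qed

lemma pow_lift:
  assumes u: "u \<in> words n"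
  shows "(\<tau> [^]\<^bsub>Aut\<^esub> (k :: int)) (lift n j u) = lift n (j + k) u"
proof (induction k rule: int_induct[where k = 0])
  case base
  show ?case by simp
next
  case (step1 k)
  thus ?case using \<tau> u by (simp add: int_pow_mult adding_machine_lift add.assoc)
next
  case (step2 k)
  have "\<tau> [^]\<^bsub>Aut\<^esub> k = \<tau> [^]\<^bsub>Aut\<^esub> (k - 1) \<otimes>\<^bsub>Aut\<^esub> \<tau>"
    using int_pow_mult[OF \<tau>, of "k - 1" 1] \<tau> by simp
  hence "\<tau> ((\<tau> [^]\<^bsub>Aut\<^esub> (k - 1)) (lift n j u)) = \<tau> (lift n (j + (k - 1)) u)"
    using step2.IH adding_machine_lift[OF u, of "j + (k - 1)"] by simp
  thus ?case using aut_tree_inj[OF \<tau>] by blast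
qed

text \<open>
  The element \<open>b\<^sub>j\<close> with \<open>[j, u] \<beta> = [j + \<epsilon> j, u b\<^sub>j]\<close>, for a function \<open>\<epsilon>\<close> that describes the activity of
  \<open>\<beta>\<close> modulo \<open>n\<close>.
\<close>

definition coord :: "(nat list \<Rightarrow> nat list) \<Rightarrow> (int \<Rightarrow> int) \<Rightarrow> int \<Rightarrow> nat list \<Rightarrow> nat list" where
  "coord \<beta> \<epsilon> j = \<tau> [^]\<^bsub>Aut\<^esub> (j div int n) \<otimes>\<^bsub>Aut\<^esub> state n \<beta> j \<otimes>\<^bsub>Aut\<^esub> \<tau> [^]\<^bsub>Aut\<^esub> (- ((j + \<epsilon> j) div int n))"

lemma coord_closed: "\<beta> \<in> carrier Aut \<Longrightarrow> coord \<beta> \<epsilon> j \<in> carrier Aut"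
  unfolding coord_def using \<tau> n state_closed by simp

lemma aut_lift:
  assumes \<beta>: "\<beta> \<in> carrier Aut" and u: "u \<in> words n"
    and act: "activity n \<beta> (nat (j mod int n)) = nat ((j + \<epsilon> j) mod int n)"
  shows "\<beta> (lift n j u) = lift n (j + \<epsilon> j) (coord \<beta> \<epsilon> j u)"
proof -
  have i: "nat (j mod int n) < n" using n by (simp add: nat_less_iff)
  have v: "(\<tau> [^]\<^bsub>Aut\<^esub> (j div int n)) u \<in> words n" using u \<tau> by simp
  have st: "state n \<beta> (int (nat (j mod int n))) = state n \<beta> j"
    using n by (simp add: state_def fun_eq_iff)
  have cancel: "(\<tau> [^]\<^bsub>Aut\<^esub> x) ((\<tau> [^]\<^bsub>Aut\<^esub> (- x)) w) = w" for x :: int and w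
  proof -
    have "\<tau> [^]\<^bsub>Aut\<^esub> (- x) \<otimes>\<^bsub>Aut\<^esub> \<tau> [^]\<^bsub>Aut\<^esub> x = \<one>\<^bsub>Aut\<^esub>" using \<tau> by (simp add: int_pow_mult[symmetric])
    hence "(\<tau> [^]\<^bsub>Aut\<^esub> (- x) \<otimes>\<^bsub>Aut\<^esub> \<tau> [^]\<^bsub>Aut\<^esub> x) w = \<one>\<^bsub>Aut\<^esub> w" by simp
    thus ?thesis by (simp only: mult_aut_tree one_aut_tree)
  qed
  show ?thesis
    unfolding lift_def coord_def aut_tree_Cons[OF \<beta> i v] act st by (simp add: cancel)
qed

lemma conj_lift:
  assumes \<beta>: "\<beta> \<in> carrier Aut" and u: "u \<in> words n"
    and act: "\<And>j. activity n \<beta> (nat (j mod int n)) = nat ((j + \<epsilon> j) mod int n)"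
  shows "(\<tau> [^]\<^bsub>Aut\<^esub> (- k) \<otimes>\<^bsub>Aut\<^esub> \<beta> \<otimes>\<^bsub>Aut\<^esub> \<tau> [^]\<^bsub>Aut\<^esub> k) (lift n j u)
    = lift n (j + \<epsilon> (j - k)) (coord \<beta> \<epsilon> (j - k) u)"
proof -
  have "\<beta> (lift n (j - k) u) = lift n (j - k + \<epsilon> (j - k)) (coord \<beta> \<epsilon> (j - k) u)"
    by (rule aut_lift[OF \<beta> u act])
  moreover have "coord \<beta> \<epsilon> (j - k) u \<in> words n" using u coord_closed[OF \<beta>] by simp
  ultimately show ?thesis using pow_lift[OF u, of "- k" j] by (simp add: pow_lift)
qed

lemma conj_in_normalized_subgroup:
  assumes B: "subgroup B Aut" and N: "\<tau> \<in> normalizer Aut B" and \<beta>: "\<beta> \<in> B"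
  shows "\<tau> [^]\<^bsub>Aut\<^esub> (- k) \<otimes>\<^bsub>Aut\<^esub> \<beta> \<otimes>\<^bsub>Aut\<^esub> \<tau> [^]\<^bsub>Aut\<^esub> (k :: int) \<in> B"
proof -
  have BG: "B \<subseteq> carrier Aut" by (rule subgroup.subset[OF B])
  have "\<tau> [^]\<^bsub>Aut\<^esub> (- k) \<in> normalizer Aut B"
    by (rule subgroup_int_pow_closed[OF normalizer_imp_subgroup[OF BG] N])
  hence "\<tau> [^]\<^bsub>Aut\<^esub> (- k) <#\<^bsub>Aut\<^esub> B #>\<^bsub>Aut\<^esub> inv\<^bsub>Aut\<^esub> (\<tau> [^]\<^bsub>Aut\<^esub> (- k)) = B"
    using BG by (simp add: normalizer_def stabilizer_def)
  hence "\<tau> [^]\<^bsub>Aut\<^esub> (- k) \<otimes>\<^bsub>Aut\<^esub> \<beta> \<otimes>\<^bsub>Aut\<^esub> inv\<^bsub>Aut\<^esub> (\<tau> [^]\<^bsub>Aut\<^esub> (- k)) \<in> B"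
    using \<beta> by (auto simp: l_coset_def r_coset_def)
  thus ?thesis using \<tau> by (simp add: int_pow_neg)
qed

lemma commute_conj:
  assumes B: "subgroup B Aut" and comm: "comm_group (Aut\<lparr>carrier := B\<rparr>)"
    and N: "\<tau> \<in> normalizer Aut B" and \<beta>: "\<beta> \<in> B"
  defines "\<gamma> k \<equiv> \<tau> [^]\<^bsub>Aut\<^esub> (- k) \<otimes>\<^bsub>Aut\<^esub> \<beta> \<otimes>\<^bsub>Aut\<^esub> \<tau> [^]\<^bsub>Aut\<^esub> (k :: int)"
  shows "\<beta> (\<gamma> k u) = \<gamma> k (\<beta> u)"
proof -
  interpret B: comm_group "Aut\<lparr>carrier := B\<rparr>" by (rule comm)
  have "\<gamma> k \<otimes>\<^bsub>Aut\<^esub> \<beta> = \<beta> \<otimes>\<^bsub>Aut\<^esub> \<gamma> k"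
    using B.m_comm[of "\<gamma> k" \<beta>] \<beta> conj_in_normalized_subgroup[OF B N \<beta>] by (simp add: \<gamma>_def)
  hence "(\<gamma> k \<otimes>\<^bsub>Aut\<^esub> \<beta>) u = (\<beta> \<otimes>\<^bsub>Aut\<^esub> \<gamma> k) u" by simp
  thus ?thesis by (simp only: mult_aut_tree)
qed

text \<open>
  For \<open>k = j - l\<close>, comparing the effect of \<open>\<beta> \<gamma>\<close> and \<open>\<gamma> \<beta>\<close> on \<open>[j, u]\<close>, where \<open>\<gamma>\<close> is the conjugate of \<open>\<beta>\<close>
  by \<open>\<tau>\<^sup>k\<close>, gives the relation for \<open>j\<close> and \<open>l\<close>: both lead to the index \<open>j + \<epsilon> j + \<epsilon> l\<close>, since \<open>\<epsilon>\<close> is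
  invariant under translation by its own values.
\<close>

lemma twisted_family_coord:
  assumes B: "subgroup B Aut" and comm: "comm_group (Aut\<lparr>carrier := B\<rparr>)"
    and N: "\<tau> \<in> normalizer Aut B" and \<beta>: "\<beta> \<in> B"
    and E_s: "\<And>j :: int. j + s \<in> E \<longleftrightarrow> j \<in> E"
    and \<epsilon>_def: "\<epsilon> = (\<lambda>j. if j \<in> E then s else 0)"
    and act: "\<And>j. activity n \<beta> (nat (j mod int n)) = nat ((j + \<epsilon> j) mod int n)"
  shows "twisted_family Aut (coord \<beta> \<epsilon>) E s"
proof unfold_locales
  have \<beta>G: "\<beta> \<in> carrier Aut" using subgroup.mem_carrier[OF B \<beta>] .
  show closed: "coord \<beta> \<epsilon> j \<in> carrier Aut" for j by (rule coord_closed[OF \<beta>G])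
  show "j + s \<in> E \<longleftrightarrow> j \<in> E" for j by (rule E_s)
  fix j l :: int
  have \<epsilon>_inv: "\<epsilon> (i + \<epsilon> i') = \<epsilon> i" for i i' using E_s by (simp add: \<epsilon>_def)
  let ?\<gamma> = "\<tau> [^]\<^bsub>Aut\<^esub> (- (j - l)) \<otimes>\<^bsub>Aut\<^esub> \<beta> \<otimes>\<^bsub>Aut\<^esub> \<tau> [^]\<^bsub>Aut\<^esub> (j - l)"
  have "coord \<beta> \<epsilon> j \<otimes>\<^bsub>Aut\<^esub> coord \<beta> \<epsilon> (l + \<epsilon> j) = coord \<beta> \<epsilon> l \<otimes>\<^bsub>Aut\<^esub> coord \<beta> \<epsilon> (j + \<epsilon> l)"
  proof (rule aut_tree_eqI)
    fix u assume u: "u \<in> words n"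
    have words: "coord \<beta> \<epsilon> i u \<in> words n" for i using u closed by simp
    have 1: "\<beta> (lift n i v) = lift n (i + \<epsilon> i) (coord \<beta> \<epsilon> i v)" if "v \<in> words n" for i v
      by (rule aut_lift[OF \<beta>G that act])
    have 2: "?\<gamma> (lift n i v) = lift n (i + \<epsilon> (i - (j - l))) (coord \<beta> \<epsilon> (i - (j - l)) v)"
      if "v \<in> words n" for i v
      by (rule conj_lift[OF \<beta>G that act])
    have \<gamma>\<beta>: "?\<gamma> (\<beta> (lift n j u)) = lift n (j + \<epsilon> j + \<epsilon> l) (coord \<beta> \<epsilon> (l + \<epsilon> j) (coord \<beta> \<epsilon> j u))"
      unfolding 1[OF u] 2[OF words] using \<epsilon>_inv[of l j] by (simp add: algebra_simps)
    have \<beta>\<gamma>: "\<beta> (?\<gamma> (lift n j u)) = lift n (j + \<epsilon> j + \<epsilon> l) (coord \<beta> \<epsilon> (j + \<epsilon> l) (coord \<beta> \<epsilon> l u))"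
      unfolding 2[OF u] using 1[OF words] \<epsilon>_inv[of j l] by (simp add: algebra_simps)
    have "coord \<beta> \<epsilon> (l + \<epsilon> j) (coord \<beta> \<epsilon> j u) = coord \<beta> \<epsilon> (j + \<epsilon> l) (coord \<beta> \<epsilon> l u)"
      by (rule lift_inj[OF trans[OF trans[OF \<gamma>\<beta>[symmetric] commute_conj[OF B comm N \<beta>, symmetric]] \<beta>\<gamma>]])
    thus "(coord \<beta> \<epsilon> j \<otimes>\<^bsub>Aut\<^esub> coord \<beta> \<epsilon> (l + \<epsilon> j)) u = (coord \<beta> \<epsilon> l \<otimes>\<^bsub>Aut\<^esub> coord \<beta> \<epsilon> (j + \<epsilon> l)) u"
      by (simp only: mult_aut_tree)
  qed (use closed in auto)
  thus "coord \<beta> \<epsilon> j \<otimes>\<^bsub>Aut\<^esub> coord \<beta> \<epsilon> (l + (if j \<in> E then s else 0))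
      = coord \<beta> \<epsilon> l \<otimes>\<^bsub>Aut\<^esub> coord \<beta> \<epsilon> (j + (if l \<in> E then s else 0))"
    by (simp add: \<epsilon>_def)
qed

lemma adding_machine_coord:
  fixes \<epsilon> :: "int \<Rightarrow> int"
  assumes \<beta>: "\<beta> \<in> carrier Aut" and \<epsilon>: "\<epsilon> (j + int n) = \<epsilon> j"
  shows "\<tau> \<otimes>\<^bsub>Aut\<^esub> coord \<beta> \<epsilon> j = coord \<beta> \<epsilon> (j + int n) \<otimes>\<^bsub>Aut\<^esub> \<tau>"
proof -
  have st: "state n \<beta> (j + int n) = state n \<beta> j" by (simp add: state_def mod_add_self2 cong: if_cong)
  have "(j + int n) div int n = 1 + j div int n" "(j + int n + \<epsilon> j) div int n = (j + \<epsilon> j) div int n + 1"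
    using n div_add_self2[of "int n" j] div_add_self2[of "int n" "j + \<epsilon> j"]
    by (simp_all add: add_ac)
  moreover have "\<tau> [^]\<^bsub>Aut\<^esub> (1 + j div int n) = \<tau> \<otimes>\<^bsub>Aut\<^esub> \<tau> [^]\<^bsub>Aut\<^esub> (j div int n)"
    using int_pow_mult[OF \<tau>, of 1] \<tau> by simp
  moreover have "\<tau> [^]\<^bsub>Aut\<^esub> (- (x + 1)) \<otimes>\<^bsub>Aut\<^esub> \<tau> = \<tau> [^]\<^bsub>Aut\<^esub> (- x)" for x :: int
    using int_pow_mult[OF \<tau>, of "- (x + 1)" 1] \<tau> by simp
  ultimately show ?thesis
    unfolding coord_def \<epsilon> st using \<tau> n state_closed[OF \<beta>] by (simp add: m_assoc)
qed

lemma H_grp_eq: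
  assumes \<beta>: "\<beta> \<in> carrier Aut"
  shows "H_grp n \<beta> = generate Aut (range (coord \<beta> \<epsilon>) \<union> {\<tau>})"
proof -
  have "generate Aut (range (coord \<beta> \<epsilon>) \<union> {\<tau>}) = generate Aut (state n \<beta> ` {0..<int n} \<union> {\<tau>})"
  proof (rule generate_range_eq)
    show "\<exists>(x :: int) (y :: int). coord \<beta> \<epsilon> j = \<tau> [^]\<^bsub>Aut\<^esub> x \<otimes>\<^bsub>Aut\<^esub> state n \<beta> (j mod int n) \<otimes>\<^bsub>Aut\<^esub> \<tau> [^]\<^bsub>Aut\<^esub> y" for j
    proof -
      have "state n \<beta> (j mod int n) = state n \<beta> j" by (simp add: state_def fun_eq_iff)
      thus ?thesis unfolding coord_def by (intro exI) simp
    qed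
  qed (use \<tau> n state_closed[OF \<beta>] in auto)
  moreover have "state n \<beta> ` {0..<int n} = {state n \<beta> (int i) | i. i < n}"
    by (auto simp: image_iff) (metis nat_0_le nat_less_iff of_nat_0_le_iff)
  ultimately show ?thesis by (simp only: H_grp_def)
qed

end

section \<open>Activities\<close>

lemma sigma_tau_mod:
  assumes "n > 0"
  shows "sigma_tau n (nat (j mod int n)) = nat ((j + 1) mod int n)"
proof -
  define x where "x = nat (j mod int n)"
  have x: "j mod int n = int x" "x < n" using assms by (simp_all add: x_def nat_less_iff)
  have "(j + 1) mod int n = (int x + 1) mod int n" unfolding x(1)[symmetric] by (simp add: mod_simps)
  also have "\<dots> = int ((x + 1) mod n)" by (simp add: zmod_int add.commute)
  finally show ?thesis using x(2) by (simp add: sigma_tau_def x_def[symmetric])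
qed

lemma sigma_tau_closed:
  assumes "n > 0"
  shows "sigma_tau n \<in> carrier (perm_group {..<n})"
proof -
  have surj: "x \<in> sigma_tau n ` {..<n}" if "x < n" for x
  proof -
    have "x = sigma_tau n (nat ((int x - 1) mod int n))"
      using sigma_tau_mod[OF assms, of "int x - 1"] that by simp
    moreover have "nat ((int x - 1) mod int n) < n" using assms by (simp add: nat_less_iff)
    ultimately show ?thesis by blast
  qed
  have img: "sigma_tau n ` {..<n} = {..<n}"
    using surj assms by (auto simp: sigma_tau_def)
  hence "bij_betw (sigma_tau n) {..<n} {..<n}"
    by (simp add: bij_betw_def eq_card_imp_inj_on)
  hence "sigma_tau n permutes {..<n}"
    by (rule bij_imp_permutes) (simp add: sigma_tau_def)
  thus ?thesis by (simp add: perm_group_def)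
qed

lemma sigma_tau_pow:
  assumes n: "n > 0"
  shows "(sigma_tau n [^]\<^bsub>perm_group {..<n}\<^esub> (k :: int)) (nat (j mod int n)) = nat ((j + k) mod int n)"
proof -
  interpret P: group "perm_group {..<n}" by (rule group_perm_group)
  note \<sigma> = sigma_tau_closed[OF n]
  have mult: "(p \<otimes>\<^bsub>perm_group {..<n}\<^esub> q) x = q (p x)" for p q x by (simp add: perm_group_def)
  have inj: "x = y" if "sigma_tau n x = sigma_tau n y" for x y
    using \<sigma> that permutes_inj[of "sigma_tau n"] by (auto simp: perm_group_def dest: injD)
  show ?thesis
  proof (induction k rule: int_induct[where k = 0])
    case base
    show ?case by (simp add: perm_group_def)
  next
    case (step1 k)
    thus ?case using \<sigma> sigma_tau_mod[OF n, of "j + k"] by (simp add: P.int_pow_mult mult add.assoc)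
  next
    case (step2 k)
    have "sigma_tau n [^]\<^bsub>perm_group {..<n}\<^esub> k
        = sigma_tau n [^]\<^bsub>perm_group {..<n}\<^esub> (k - 1) \<otimes>\<^bsub>perm_group {..<n}\<^esub> sigma_tau n"
      using P.int_pow_mult[OF \<sigma>, of "k - 1" 1] \<sigma> by simp
    hence "sigma_tau n ((sigma_tau n [^]\<^bsub>perm_group {..<n}\<^esub> (k - 1)) (nat (j mod int n)))
        = sigma_tau n (nat ((j + (k - 1)) mod int n))"
      using step2.IH sigma_tau_mod[OF n, of "j + (k - 1)"] by (simp add: mult)
    thus ?case by (rule inj)
  qed
qed

lemma cycle_len_pos: "n > 0 \<Longrightarrow> cycle_len n s > 0"
  and cycle_len_mult: "n > 0 \<Longrightarrow> int (cycle_len n s) * s = (s div gcd (int n) s) * int n"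
proof -
  assume n: "n > 0"
  define g where "g = gcd (int n) s"
  have g: "g > 0" "g dvd int n" "g dvd s" using n by (auto simp: g_def)
  obtain a where a: "int n = g * a" using g(2) by blast
  obtain c where c: "s = g * c" using g(3) by blast
  have len: "int (cycle_len n s) = a"
    unfolding cycle_len_def g_def[symmetric] using g(1) a by (simp add: zdiv_int)
  have "a > 0" using a n g(1) by (metis of_nat_0_less_iff zero_less_mult_pos)
  thus "cycle_len n s > 0" using len by linarith
  show "int (cycle_len n s) * s = (s div gcd (int n) s) * int n"
    unfolding len g_def[symmetric] using g(1) a by (simp add: c)
qed

lemma metabelian_imp_metabelian_by_finite:
  assumes "metabelian G"
  shows "metabelian_by_finite G"
proof -
  interpret group G using assms by (simp add: metabelian_def)
  interpret N: normal "carrier G" G by (rule normal_self)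
  have "carrier (G Mod carrier G) = {carrier G}"
    unfolding carrier_FactGroup using coset_join2[OF _ subgroup_self] by auto
  hence "finite (carrier (G Mod carrier G))" by simp
  thus ?thesis unfolding metabelian_by_finite_def using normal_self assms by (intro exI[of _ "carrier G"]) simp
qed

section \<open>Abelian groups normalized by the adding machine\<close>

locale normalized_abelian =
  fixes n :: nat and B :: "(nat list \<Rightarrow> nat list) set" and \<beta> :: "nat list \<Rightarrow> nat list"
  assumes n: "n > 0"
    and B: "subgroup B (aut_tree n)"
    and comm: "comm_group (aut_tree n\<lparr>carrier := B\<rparr>)"
    and normalizes: "adding_machine n \<in> normalizer (aut_tree n) B"
    and \<beta>_B: "\<beta> \<in> B"
begin

sublocale group "aut_tree n" by (rule group_aut_tree)

lemma \<tau>_closed: "adding_machine n \<in> carrier (aut_tree n)"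
  using normalizes by (simp add: normalizer_def stabilizer_def)

lemma \<beta>_closed: "\<beta> \<in> carrier (aut_tree n)"
  using subgroup.mem_carrier[OF B \<beta>_B] .

lemma metabelian_H:
  assumes E_s: "\<And>j :: int. j + s \<in> E \<longleftrightarrow> j \<in> E" and E_n: "\<And>j. j + int n \<in> E \<longleftrightarrow> j \<in> E"
    and act: "\<And>j. activity n \<beta> (nat (j mod int n)) = nat ((j + (if j \<in> E then s else 0)) mod int n)"
  shows "metabelian (aut_tree n\<lparr>carrier := H_grp n \<beta>\<rparr>)"
proof -
  define \<epsilon> where "\<epsilon> = (\<lambda>j. if j \<in> E then s else 0)"
  interpret twisted_family "aut_tree n" "coord n \<beta> \<epsilon>" E s
    using twisted_family_coord[OF n \<tau>_closed B comm normalizes \<beta>_B E_s \<epsilon>_def] act by (simp add: \<epsilon>_def)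
  show ?thesis
    unfolding H_grp_eq[OF n \<tau>_closed \<beta>_closed, of \<epsilon>]
  proof (rule metabelian_family[OF \<tau>_closed E_n])
    show "adding_machine n \<otimes>\<^bsub>aut_tree n\<^esub> coord n \<beta> \<epsilon> j = coord n \<beta> \<epsilon> (j + int n) \<otimes>\<^bsub>aut_tree n\<^esub> adding_machine n" for j
      by (rule adding_machine_coord[OF n \<tau>_closed \<beta>_closed]) (simp add: \<epsilon>_def E_n)
  qed
qed

lemma activity_power:
  assumes "activity n \<beta> = sigma_tau n [^]\<^bsub>perm_group {..<n}\<^esub> (s :: int)"
  shows "activity n \<beta> (nat (j mod int n)) = nat ((j + s) mod int n)"
  unfolding assms by (rule sigma_tau_pow[OF n])

lemma power_activity:
  fixes s :: int
  assumes act: "activity n \<beta> = sigma_tau n [^]\<^bsub>perm_group {..<n}\<^esub> s"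
  shows "metabelian_by_finite (aut_tree n\<lparr>carrier := H_grp n \<beta>\<rparr>) \<and>
    comm_group (aut_tree n\<lparr>carrier := K_grp n s \<beta>\<rparr>) \<and>
    O_grp n s \<beta> \<lhd> aut_tree n\<lparr>carrier := H_grp n \<beta>\<rparr> \<and>
    K_grp n s \<beta> \<lhd> aut_tree n\<lparr>carrier := O_grp n s \<beta>\<rparr> \<and>
    homomorphic_image_of_subgroup (aut_tree n\<lparr>carrier := H_grp n \<beta>\<rparr> Mod O_grp n s \<beta>)
      (wreath (integer_mod_group (cycle_len n s)) (integer_mod_group n))"
proof -
  define b where "b = coord n \<beta> (\<lambda>_. s)"
  interpret tw: twisted_family "aut_tree n" b UNIV s
    unfolding b_def
    by (rule twisted_family_coord[OF n \<tau>_closed B comm normalizes \<beta>_B]) (simp_all add: activity_power[OF act])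
  interpret N: normalized_shift_family "aut_tree n" b s "adding_machine n" "int n" "cycle_len n s" "s div gcd (int n) s"
  proof unfold_locales
    show "b j \<in> carrier (aut_tree n)" for j by (rule tw.b_closed)
    show "b i \<otimes>\<^bsub>aut_tree n\<^esub> b (j + s) = b j \<otimes>\<^bsub>aut_tree n\<^esub> b (i + s)" for i j using tw.twist_in by simp
    show "adding_machine n \<otimes>\<^bsub>aut_tree n\<^esub> b j = b (j + int n) \<otimes>\<^bsub>aut_tree n\<^esub> adding_machine n" for j
      unfolding b_def by (rule adding_machine_coord[OF n \<tau>_closed \<beta>_closed]) simp
  qed (use n \<tau>_closed cycle_len_pos cycle_len_mult in auto)
  have H: "H_grp n \<beta> = N.H_sub"
    unfolding N.H_sub_def using H_grp_eq[OF n \<tau>_closed \<beta>_closed] by (simp only: b_def)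
  have c: "N.c = state n \<beta>"
  proof
    fix j
    have bj: "b j = adding_machine n [^]\<^bsub>aut_tree n\<^esub> (j div int n) \<otimes>\<^bsub>aut_tree n\<^esub> state n \<beta> j
        \<otimes>\<^bsub>aut_tree n\<^esub> adding_machine n [^]\<^bsub>aut_tree n\<^esub> (- ((j + s) div int n))"
      unfolding b_def by (rule coord_def[OF n \<tau>_closed])
    have "N.c j = (adding_machine n [^]\<^bsub>aut_tree n\<^esub> (- (j div int n)) \<otimes>\<^bsub>aut_tree n\<^esub> adding_machine n [^]\<^bsub>aut_tree n\<^esub> (j div int n))
        \<otimes>\<^bsub>aut_tree n\<^esub> state n \<beta> j \<otimes>\<^bsub>aut_tree n\<^esub> (adding_machine n [^]\<^bsub>aut_tree n\<^esub> (- ((j + s) div int n))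
        \<otimes>\<^bsub>aut_tree n\<^esub> adding_machine n [^]\<^bsub>aut_tree n\<^esub> ((j + s) div int n))"
      unfolding N.c_def bj
      using \<tau>_closed state_closed[OF \<beta>_closed n] by (simp add: m_assoc)
    thus "N.c j = state n \<beta> j"
      using \<tau>_closed state_closed[OF \<beta>_closed n] by (simp add: int_pow_mult[symmetric])
  qed
  have pi: "pi_prod n s \<beta> i = N.p (int i)" if "i < n" for i
  proof -
    have "pi_prod n s \<beta> i = list_prod (aut_tree n) N.c (shifted s 0 (replicate (cycle_len n s) (int i)))"
      by (simp add: pi_prod_def list_prod_def shifted_replicate c comp_def)
    thus ?thesis using N.list_prod_c_eq_p[of "int i"] that by simp
  qed
  have int_img: "{0..<int n} = int ` {..<n}"
    by (simp add: lessThan_atLeast0 image_int_atLeastLessThan)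
  have K: "K_grp n s \<beta> = N.K_sub"
  proof -
    have "{commutator (aut_tree n) (state n \<beta> (int i)) (adding_machine n [^]\<^bsub>aut_tree n\<^esub> k) | i (k :: int). i < n}
        = {commutator (aut_tree n) (N.c i) (adding_machine n [^]\<^bsub>aut_tree n\<^esub> k) | i (k :: int). i \<in> {0..<int n}}"
      unfolding c int_img by blast
    moreover have "{pi_prod n s \<beta> i | i. i < n} = N.p ` {0..<int n}"
      unfolding int_img by (auto simp: pi) (metis pi)
    ultimately show ?thesis unfolding K_grp_def N.K_sub_eq[symmetric] by simp
  qed
  have O: "O_grp n s \<beta> = N.O_sub" unfolding O_grp_def K by (rule N.O_eq_set_mult[symmetric])
  show ?thesis
    unfolding H K O
    using metabelian_imp_metabelian_by_finite[OF N.H_metabelian] N.comm_group_K N.O_normal_H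
      N.K_normal_O N.H_quotient by simp
qed

text \<open>
  If the activity of \<open>\<beta>\<close> is the transposition of \<open>i\<close> and \<open>j\<close>, the conjugate of \<open>\<beta>\<close> by \<open>\<tau>\<close> to the power
  \<open>k = j - i\<close> acts on the letters as the transposition of \<open>j\<close> and \<open>j + k\<close>.  The two transpositions share
  the letter \<open>j\<close>, so they commute only if they coincide, that is, if \<open>j + k\<close> is \<open>i\<close> modulo \<open>n\<close>.
\<close>

lemma transposition_distance:
  assumes i: "i < n" and j: "j < n" and ij: "i \<noteq> j" and act: "activity n \<beta> = transpose i j"
  shows "int n dvd 2 * (int j - int i)"
proof (rule ccontr)
  assume no: "\<not> int n dvd 2 * (int j - int i)"
  define k where "k = int j - int i"
  let ?r = "\<lambda>x :: int. nat (x mod int n)"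
  define \<gamma> where "\<gamma> = adding_machine n [^]\<^bsub>aut_tree n\<^esub> (- k) \<otimes>\<^bsub>aut_tree n\<^esub> \<beta> \<otimes>\<^bsub>aut_tree n\<^esub> adding_machine n [^]\<^bsub>aut_tree n\<^esub> k"
  have r: "?r x < n" for x using n by (simp add: nat_less_iff)
  have Nil: "(adding_machine n [^]\<^bsub>aut_tree n\<^esub> l) [] = []" for l :: int
    by (intro aut_tree_Nil[of _ n] int_pow_closed \<tau>_closed)
  have pow: "(adding_machine n [^]\<^bsub>aut_tree n\<^esub> l) [?r x] = [?r (x + l)]" for l x :: int
    using pow_lift[OF n \<tau>_closed, of "[]" l x] by (simp add: lift_def Nil)
  have \<beta>: "\<beta> [x] = [transpose i j x]" if "x < n" for x
    using aut_tree_letter(1)[OF \<beta>_closed that] by (simp add: act)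
  have \<gamma>: "\<gamma> [?r x] = (adding_machine n [^]\<^bsub>aut_tree n\<^esub> k) [transpose i j (?r (x - k))]" for x
    using pow[of "- k" x] \<beta>[OF r] by (simp add: \<gamma>_def)
  have ri: "?r (int i) = i" "?r (int j) = j" "?r (int j - k) = i" using i j by (simp_all add: k_def)
  have nk: "\<not> int n dvd k" using no unfolding k_def by (metis dvd_mult)
  have ne: "?r (int i - k) \<noteq> i" "?r (int i - k) \<noteq> j"
  proof -
    have *: "?r x = y \<longleftrightarrow> int n dvd x - int y" if "y < n" for x y
      using that n by (auto simp: mod_eq_dvd_iff[symmetric] nat_eq_iff)
    show "?r (int i - k) \<noteq> i" using nk by (simp add: *[OF i])
    show "?r (int i - k) \<noteq> j" using no by (simp add: *[OF j] k_def dvd_diff_commute algebra_simps)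
  qed
  have "\<gamma> (\<beta> [i]) = (adding_machine n [^]\<^bsub>aut_tree n\<^esub> k) [?r (int j)]"
    using \<beta>[OF i] \<gamma>[of "int j"] by (simp only: ri transpose_apply_first)
  also have "\<dots> = [?r (int j + k)]" by (rule pow)
  finally have 1: "\<gamma> (\<beta> [i]) = [?r (int j + k)]" .
  have "\<gamma> [i] = (adding_machine n [^]\<^bsub>aut_tree n\<^esub> k) [?r (int i - k)]"
    using \<gamma>[of "int i"] ne by (simp only: ri transpose_apply_other[OF ne])
  also have "\<dots> = [i]" using pow[of k "int i - k"] ri by simp
  finally have 2: "\<beta> (\<gamma> [i]) = [?r (int j)]" using \<beta>[OF i] by (simp only: ri transpose_apply_first)
  have "?r (int j + k) = ?r (int j)"
    using commute_conj[OF n \<tau>_closed B comm normalizes \<beta>_B, of k "[i]"] 1 2 by (simp add: \<gamma>_def)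
  hence "(int j + k) mod int n = int j mod int n" using n by (simp add: eq_nat_nat_iff)
  thus False using nk by (simp add: mod_eq_dvd_iff)
qed

lemma metabelian_transposition:
  assumes i: "i < n" and j: "j < n" and ij: "i \<noteq> j" and act: "activity n \<beta> = transpose i j"
  shows "metabelian (aut_tree n\<lparr>carrier := H_grp n \<beta>\<rparr>)"
proof -
  obtain q where q: "2 * (int j - int i) = int n * q" using transposition_distance[OF assms] by blast
  have "\<bar>int j - int i\<bar> < int n" "int j \<noteq> int i" using i j ij by auto
  hence "\<bar>int n * q\<bar> < int n * 2" "q \<noteq> 0" unfolding q[symmetric] using q by auto
  hence "\<bar>q\<bar> < 2" using n by (simp add: abs_mult)
  hence q1: "q = 1 \<or> q = -1" using \<open>q \<noteq> 0\<close> by linarith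
  define r where "r = \<bar>int j - int i\<bar>"
  have nr: "int n = 2 * r" and r: "r > 0" and ji: "int j = int i + r \<or> int j = int i - r"
    using q1 q ij by (auto simp: r_def)
  \<comment> \<open>Modulo \<open>n = 2 * r\<close> this residue class consists of \<open>i\<close> and \<open>j\<close>, and adding \<open>r\<close> exchanges them.\<close>
  define E where "E = {x :: int. r dvd x - int i}"
  show ?thesis
  proof (rule metabelian_H[of r E])
    show "x + r \<in> E \<longleftrightarrow> x \<in> E" for x
      using dvd_add_left_iff[of r r "x - int i"] by (simp add: E_def algebra_simps)
    show "x + int n \<in> E \<longleftrightarrow> x \<in> E" for x
      using dvd_add_left_iff[of r "int n" "x - int i"] by (simp add: E_def nr algebra_simps)
    fix x :: int
    define y where "y = nat (x mod int n)"
    have y: "y < n" "x mod int n = int y" using n by (simp_all add: y_def nat_less_iff)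
    have shift: "(x + e) mod int n = (int y + e) mod int n" for e
      unfolding y(2)[symmetric] by (simp add: mod_simps)
    have "r dvd x - x mod int n" unfolding nr by (metis dvd_mult2 dvd_minus_mod dvd_trans dvd_triv_right)
    hence "r dvd x - int i \<longleftrightarrow> r dvd int y - int i"
      unfolding y(2) using dvd_diff_commute dvd_add_right_iff[of r "x - int y" "int y - int i"] by simp
    hence xE: "x \<in> E \<longleftrightarrow> r dvd int y - int i" by (simp add: E_def)
    have half: "(int a + r) mod int n = int b" if "int b = int a + r \<or> int b = int a - r" "b < n" for a b
    proof -
      have "int a + r = int b \<or> int a + r = int b + int n" using that(1) nr by linarith
      thus ?thesis using that(2) by auto
    qed
    consider "y = i" | "y = j" | "y \<noteq> i" "y \<noteq> j" by blast
    thus "activity n \<beta> (nat (x mod int n)) = nat ((x + (if x \<in> E then r else 0)) mod int n)"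
    proof cases
      case 1
      have "(int i + r) mod int n = int j" by (rule half) (use ji j in auto)
      thus ?thesis using 1 by (simp add: xE shift act y(2))
    next
      case 2
      have "(int j + r) mod int n = int i" by (rule half) (use ji i in auto)
      moreover have "x \<in> E" unfolding xE 2 using ji by auto
      ultimately show ?thesis using 2 by (simp add: shift act y(2))
    next
      case 3
      have "\<not> r dvd int y - int i"
      proof
        assume "r dvd int y - int i"
        then obtain a where a: "int y - int i = r * a" by blast
        have "\<bar>r * a\<bar> < r * 2" unfolding a[symmetric] using y(1) i nr by linarith
        hence "\<bar>a\<bar> < 2" using r by (simp add: abs_mult)
        hence "a = -1 \<or> a = 0 \<or> a = 1" by linarith
        thus False using a ji 3 y(1) i j nr by auto
      qed
      thus ?thesis using 3 y(1) by (simp add: xE shift act y(2) transpose_apply_other)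
    qed
  qed
qed

end

theorem theoremB:
  fixes n :: nat
    and B :: "(nat list \<Rightarrow> nat list) set"
    and \<beta> :: "nat list \<Rightarrow> nat list"
  assumes "n \<ge> 2"
    and "subgroup B (aut_tree n)"
    and "comm_group ((aut_tree n)\<lparr>carrier := B\<rparr>)"
    and "adding_machine n \<in> normalizer (aut_tree n) B"
    and "\<beta> \<in> B"
  shows "(\<forall>s :: int. activity n \<beta> = sigma_tau n [^]\<^bsub>perm_group {..<n}\<^esub> s \<longrightarrow>
            metabelian_by_finite ((aut_tree n)\<lparr>carrier := H_grp n \<beta>\<rparr>) \<and>
            comm_group ((aut_tree n)\<lparr>carrier := K_grp n s \<beta>\<rparr>) \<and>
            O_grp n s \<beta> \<lhd> (aut_tree n)\<lparr>carrier := H_grp n \<beta>\<rparr> \<and>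
            K_grp n s \<beta> \<lhd> (aut_tree n)\<lparr>carrier := O_grp n s \<beta>\<rparr> \<and>
            homomorphic_image_of_subgroup
              ((aut_tree n)\<lparr>carrier := H_grp n \<beta>\<rparr> Mod O_grp n s \<beta>)
              (wreath (integer_mod_group (cycle_len n s)) (integer_mod_group n))) \<and>
         (even n \<longrightarrow>
            (activity n \<beta> = sigma_tau n [^]\<^bsub>perm_group {..<n}\<^esub> (n div 2) \<or>
             (\<exists>i<n. \<exists>j<n. i \<noteq> j \<and> activity n \<beta> = transpose i j)) \<longrightarrow>
            metabelian ((aut_tree n)\<lparr>carrier := H_grp n \<beta>\<rparr>))"
proof -
  interpret normalized_abelian n B \<beta> by (rule normalized_abelian.intro) (use assms in auto)
  show ?thesis
  proof (intro conjI allI impI)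
    fix s :: int
    assume "activity n \<beta> = sigma_tau n [^]\<^bsub>perm_group {..<n}\<^esub> s"
    note * = power_activity[OF this]
    show "metabelian_by_finite ((aut_tree n)\<lparr>carrier := H_grp n \<beta>\<rparr>)"
      "comm_group ((aut_tree n)\<lparr>carrier := K_grp n s \<beta>\<rparr>)"
      "O_grp n s \<beta> \<lhd> (aut_tree n)\<lparr>carrier := H_grp n \<beta>\<rparr>"
      "K_grp n s \<beta> \<lhd> (aut_tree n)\<lparr>carrier := O_grp n s \<beta>\<rparr>"
      "homomorphic_image_of_subgroup ((aut_tree n)\<lparr>carrier := H_grp n \<beta>\<rparr> Mod O_grp n s \<beta>)
        (wreath (integer_mod_group (cycle_len n s)) (integer_mod_group n))"
      using * by blast+
  next
    assume "activity n \<beta> = sigma_tau n [^]\<^bsub>perm_group {..<n}\<^esub> (n div 2) \<or>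
      (\<exists>i<n. \<exists>j<n. i \<noteq> j \<and> activity n \<beta> = transpose i j)"
    thus "metabelian ((aut_tree n)\<lparr>carrier := H_grp n \<beta>\<rparr>)"
    proof
      assume "activity n \<beta> = sigma_tau n [^]\<^bsub>perm_group {..<n}\<^esub> (n div 2)"
      hence "activity n \<beta> = sigma_tau n [^]\<^bsub>perm_group {..<n}\<^esub> int (n div 2)"
        by (simp only: int_pow_int)
      from metabelian_H[of "int (n div 2)" UNIV] activity_power[OF this] show ?thesis by simp
    next
      assume "\<exists>i<n. \<exists>j<n. i \<noteq> j \<and> activity n \<beta> = transpose i j"
      thus ?thesis using metabelian_transposition by blast
    qed
  qed
qed

end
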